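(* There exists a nonempty open set $\mathcal{U}^2\subset\Omega^2_B$ (respectively, a nonempty open set $\mathcal{U}^2\subset\Omega^2_\omega$), with respect to the $C^\infty$-topology, such that: (a) $\mathcal{U}^2$ is determined by the $3$-jet of the vector fields, i.e. whether a vector field of $\Omega^2_B$ (respectively $\Omega^2_\omega$) belongs to $\mathcal{U}^2$ depends only on its $3$-jet at the origin; (b) each $X\in\mathcal{U}^2$ has two $2$-parameter families of periodic solutions $\gamma^1_{\sigma,\lambda}$ and $\gamma^2_{\sigma,\lambda}$, with $\sigma\in(-\epsilon,\epsilon)$ and $\lambda\in[0,2\pi]$, such that for each $\lambda_0$ and for $j=1,2$ one has $\lim_{\sigma\to0}\gamma^j_{\sigma,\lambda_0}=0$ (the orbits shrink to the equilibrium at the origin), and the periods tend to $2\pi/\alpha$ when $\sigma\to0$, where $\pm i\alpha$, $\alpha>0$, are the nonzero eigenvalues (each of multiplicity two) of $DX(0)$.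
   Context: Fix coordinates $(x_1,y_1,x_2,y_2,x_3,y_3)$ on $\mathbb{R}^6$ and the standard symplectic form $\omega=dx_1\wedge dy_1+dx_2\wedge dy_2+dx_3\wedge dy_3$. For a (germ at the origin of a) smooth function $H:(\mathbb{R}^6,0)\to\mathbb{R}$ the Hamiltonian vector field $X_H$ is given by $\dot x_i=\partial H/\partial y_i$, $\dot y_i=-\partial H/\partial x_i$, $i=1,2,3$. All Hamiltonians considered have the origin as an equilibrium point: $X_H(0)=0$. Let $R_2$ be the linear symplectic involution $R_2(x_1,y_1,x_2,y_2,x_3,y_3)=(x_1,y_1,x_2,y_2,-x_3,-y_3)$, so $\dim\mathrm{Fix}(R_2)=4$. A vector field $X$ is $R_2$-reversible if $X(R_2x)=-R_2X(x)$ for all $x$; for $X=X_H$ with $H(0)=0$ this is equivalent to $H\circ R_2=-H$. $\Omega^2$ denotes the space of $C^\infty$ $R_2$-reversible Hamiltonian vector fields on $(\mathbb{R}^6,0)$ having the origin as an equilibrium, endowed with the $C^\infty$-topology; its subsets carry the induced topology. The Poisson bracket is $\{f,g\}=\omega(X_f,X_g)$. A Hamiltonian vector field $X_H$ satisfies the Birkhoff Condition if $\{H_2,H\}=0$, where $H_2$ is the homogeneous part of degree $2$ of the Taylor expansion of $H$ at the origin. $\Omega^2_B\subset\Omega^2$ is the set of vector fields satisfying the Birkhoff Condition, and $\Omega^2_\omega\subset\Omega^2$ is the set of (real) analytic ones. For $X\in\Omega^2$ the linear part at the origin has the form $$DX(0)=\begin{pmatrix}0&0&0&0&a&b\\0&0&0&0&c&d\\0&0&0&0&e&f\\0&0&0&0&g&h\\-d&b&-h&f&0&0\\c&-a&g&-e&0&0\end{pmatrix},$$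 whose eigenvalues are $0,0,\pm\sqrt{bc-ad+fg-eh},\pm\sqrt{bc-ad+fg-eh}$; when $bc-ad+fg-eh<0$ one sets $\alpha=\sqrt{-bc+ad-fg+eh}$, which is the case considered. *)

theory Defs
  imports "HOL-Analysis.Analysis" "HOL-Computational_Algebra.Polynomial"
begin

section \<open>Smooth and analytic germs\<close>

primrec partials :: "'n list \<Rightarrow> (real^'n \<Rightarrow> 'b) \<Rightarrow> real^'n \<Rightarrow> 'b::real_normed_vector" where
  "partials [] f = f"
| "partials (j # js) f = (\<lambda>x. frechet_derivative (partials js f) (at x) (axis j 1))"

text \<open>Only used for open \<open>S\<close>.  Differentiability of all iterated partial derivatives
  makes all of them continuous, so this is the usual notion of a \<open>C\<^sup>\<infinity>\<close> map.\<close>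

definition smooth_on :: "(real^'n) set \<Rightarrow> (real^'n \<Rightarrow> 'b::real_normed_vector) \<Rightarrow> bool" where
  "smooth_on S f \<longleftrightarrow> (\<forall>js. \<forall>x\<in>S. partials js f differentiable (at x))"

text \<open>Germs at the origin are handled through representatives defined on the whole space,
  of which only the values near the origin matter.\<close>

definition smooth_germ :: "(real^'n \<Rightarrow> 'b::real_normed_vector) \<Rightarrow> bool" where
  "smooth_germ f \<longleftrightarrow> (\<exists>V. open V \<and> 0 \<in> V \<and> smooth_on V f)"

definition analytic_germ :: "(real^'n \<Rightarrow> 'b::real_normed_vector) \<Rightarrow> bool" where
  "analytic_germ f \<longleftrightarrow> (\<exists>c :: nat^'n \<Rightarrow> 'b. \<forall>\<^sub>F x in nhds 0.
     ((\<lambda>m. (\<Prod>i\<in>UNIV. x $ i ^ (m $ i)) *\<^sub>R c m) has_sum f x) UNIV)"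

definition same_jet :: "nat \<Rightarrow> (real^'n \<Rightarrow> 'b) \<Rightarrow> (real^'n \<Rightarrow> 'b::real_normed_vector) \<Rightarrow> bool" where
  "same_jet k f g \<longleftrightarrow> (\<forall>js. length js \<le> k \<longrightarrow> partials js f 0 = partials js g 0)"

text \<open>The \<open>C\<^sup>\<infinity>\<close>-topology on germs: the final topology for the maps sending a smooth
  function on an open neighbourhood \<open>V\<close> of the origin to its germ, where the functions on \<open>V\<close>
  carry the topology of uniform convergence of all derivatives on compact subsets of \<open>V\<close>.
  Since \<open>V\<close> may be shrunk, an open set contains with a function every other
  representative of its germ.\<close>

definition Cinf_open :: "(real^'n \<Rightarrow> 'b::real_normed_vector) set \<Rightarrow> bool" where
  "Cinf_open W \<longleftrightarrow> W \<subseteq> Collect smooth_germ \<and>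
     (\<forall>V f. open V \<and> 0 \<in> V \<and> f \<in> W \<and> smooth_on V f \<longrightarrow>
       (\<exists>K k e. compact K \<and> K \<subseteq> V \<and> 0 < e \<and>
         (\<forall>g. smooth_on V g \<and>
              (\<forall>x\<in>K. \<forall>js. length js \<le> k \<longrightarrow> dist (partials js g x) (partials js f x) < e)
            \<longrightarrow> g \<in> W)))"

definition Cinf_topology :: "(real^'n \<Rightarrow> 'b::real_normed_vector) topology" where
  "Cinf_topology = topology Cinf_open"

lemma istopology_Cinf_open: "istopology Cinf_open"
  unfolding istopology_def
proof (intro conjI allI impI)
  fix S T :: "(real^'n \<Rightarrow> 'b) set"
  assume S: "Cinf_open S" and T: "Cinf_open T"
  show "Cinf_open (S \<inter> T)"
    unfolding Cinf_open_def
  proof (intro conjI allI impI)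
    show "S \<inter> T \<subseteq> Collect smooth_germ"
      using S unfolding Cinf_open_def by blast
  next
    fix V and f :: "real^'n \<Rightarrow> 'b"
    assume f: "open V \<and> 0 \<in> V \<and> f \<in> S \<inter> T \<and> smooth_on V f"
    obtain K1 k1 e1 where 1: "compact K1" "K1 \<subseteq> V" "(0::real) < e1"
      "\<And>g. smooth_on V g \<Longrightarrow>
        (\<forall>x\<in>K1. \<forall>js. length js \<le> k1 \<longrightarrow> dist (partials js g x) (partials js f x) < e1) \<Longrightarrow> g \<in> S"
      using S f unfolding Cinf_open_def by (metis IntD1)
    obtain K2 k2 e2 where 2: "compact K2" "K2 \<subseteq> V" "(0::real) < e2"
      "\<And>g. smooth_on V g \<Longrightarrow>
        (\<forall>x\<in>K2. \<forall>js. length js \<le> k2 \<longrightarrow> dist (partials js g x) (partials js f x) < e2) \<Longrightarrow> g \<in> T"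
      using T f unfolding Cinf_open_def by (metis IntD2)
    show "\<exists>K k e. compact K \<and> K \<subseteq> V \<and> 0 < e \<and>
         (\<forall>g. smooth_on V g \<and>
              (\<forall>x\<in>K. \<forall>js. length js \<le> k \<longrightarrow> dist (partials js g x) (partials js f x) < e)
            \<longrightarrow> g \<in> S \<inter> T)"
    proof (rule exI[of _ "K1 \<union> K2"], rule exI[of _ "max k1 k2"], rule exI[of _ "min e1 e2"],
        intro conjI allI impI)
      show "compact (K1 \<union> K2)" "K1 \<union> K2 \<subseteq> V" "0 < min e1 e2"
        using 1 2 by auto
    next
      fix g :: "real^'n \<Rightarrow> 'b"
      assume g: "smooth_on V g \<and>
              (\<forall>x\<in>K1 \<union> K2. \<forall>js. length js \<le> max k1 k2 \<longrightarrow>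
                 dist (partials js g x) (partials js f x) < min e1 e2)"
      have "g \<in> S" by (rule 1(4)) (use g in auto)
      moreover have "g \<in> T" by (rule 2(4)) (use g in auto)
      ultimately show "g \<in> S \<inter> T" by blast
    qed
  qed
next
  fix \<K> :: "(real^'n \<Rightarrow> 'b) set set"
  assume K: "\<forall>S\<in>\<K>. Cinf_open S"
  show "Cinf_open (\<Union>\<K>)"
    unfolding Cinf_open_def
  proof (intro conjI allI impI)
    show "\<Union>\<K> \<subseteq> Collect smooth_germ"
      using K unfolding Cinf_open_def by blast
  next
    fix V and f :: "real^'n \<Rightarrow> 'b"
    assume f: "open V \<and> 0 \<in> V \<and> f \<in> \<Union>\<K> \<and> smooth_on V f"
    then obtain S where S: "S \<in> \<K>" "f \<in> S" by blast
    obtain K1 k1 e1 where "compact K1" "K1 \<subseteq> V" "(0::real) < e1"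
      "\<And>g. smooth_on V g \<Longrightarrow>
        (\<forall>x\<in>K1. \<forall>js. length js \<le> k1 \<longrightarrow> dist (partials js g x) (partials js f x) < e1) \<Longrightarrow> g \<in> S"
      using K S f unfolding Cinf_open_def by metis
    then show "\<exists>K k e. compact K \<and> K \<subseteq> V \<and> 0 < e \<and>
         (\<forall>g. smooth_on V g \<and>
              (\<forall>x\<in>K. \<forall>js. length js \<le> k \<longrightarrow> dist (partials js g x) (partials js f x) < e)
            \<longrightarrow> g \<in> \<Union>\<K>)"
      using S(1) by (meson UnionI)
  qed
qed

lemma openin_Cinf_topology: "openin Cinf_topology W \<longleftrightarrow> Cinf_open W"
  by (simp add: Cinf_topology_def topology_inverse' istopology_Cinf_open)


section \<open>Reversible Hamiltonian vector fields on six-dimensional space\<close>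

text \<open>The coordinates \<open>1, \<dots>, 6\<close> are \<open>x\<^sub>1, y\<^sub>1, x\<^sub>2, y\<^sub>2, x\<^sub>3, y\<^sub>3\<close>, in this order.\<close>

lemma vector_6_nth:
  "(vector [a, b, c, d, e, f] :: 'a::zero^6) $ 1 = a"
  "(vector [a, b, c, d, e, f] :: 'a::zero^6) $ 2 = b"
  "(vector [a, b, c, d, e, f] :: 'a::zero^6) $ 3 = c"
  "(vector [a, b, c, d, e, f] :: 'a::zero^6) $ 4 = d"
  "(vector [a, b, c, d, e, f] :: 'a::zero^6) $ 5 = e"
  "(vector [a, b, c, d, e, f] :: 'a::zero^6) $ 6 = f"
  by (simp_all add: vector_def)

definition symp :: "real^6 \<Rightarrow> real^6 \<Rightarrow> real" where
  "symp u v = (u$1 * v$2 - u$2 * v$1) + (u$3 * v$4 - u$4 * v$3) + (u$5 * v$6 - u$6 * v$5)"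

definition ham_vf :: "(real^6 \<Rightarrow> real) \<Rightarrow> real^6 \<Rightarrow> real^6" where
  "ham_vf H x = vector
     [partials [2] H x, - partials [1] H x,
      partials [4] H x, - partials [3] H x,
      partials [6] H x, - partials [5] H x]"

definition poisson :: "(real^6 \<Rightarrow> real) \<Rightarrow> (real^6 \<Rightarrow> real) \<Rightarrow> real^6 \<Rightarrow> real" where
  "poisson f g x = symp (ham_vf f x) (ham_vf g x)"

definition R2 :: "real^6 \<Rightarrow> real^6" where
  "R2 x = vector [x$1, x$2, x$3, x$4, - x$5, - x$6]"

definition is_hamiltonian_of :: "(real^6 \<Rightarrow> real) \<Rightarrow> (real^6 \<Rightarrow> real^6) \<Rightarrow> bool" where
  "is_hamiltonian_of H X \<longleftrightarrow> smooth_germ H \<and> (\<forall>\<^sub>F x in nhds 0. X x = ham_vf H x)"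

definition Omega2 :: "(real^6 \<Rightarrow> real^6) set" where
  "Omega2 = {X. (\<exists>H. is_hamiltonian_of H X) \<and> X 0 = 0 \<and>
                (\<forall>\<^sub>F x in nhds 0. X (R2 x) = - R2 (X x))}"

definition quadratic_part :: "(real^6 \<Rightarrow> real) \<Rightarrow> real^6 \<Rightarrow> real" where
  "quadratic_part H x = (\<Sum>i\<in>UNIV. \<Sum>j\<in>UNIV. partials [i, j] H 0 * x$i * x$j) / 2"

text \<open>The Hamiltonian of a germ is unique up to an additive constant, which does not
  affect the Birkhoff condition.\<close>

definition Omega2_Birkhoff :: "(real^6 \<Rightarrow> real^6) set" where
  "Omega2_Birkhoff = {X \<in> Omega2. \<exists>H. is_hamiltonian_of H X \<and>
     (\<forall>\<^sub>F x in nhds 0. poisson (quadratic_part H) H x = 0)}"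

definition Omega2_analytic :: "(real^6 \<Rightarrow> real^6) set" where
  "Omega2_analytic = {X \<in> Omega2. analytic_germ X}"


section \<open>Eigenvalues and families of periodic solutions\<close>

definition charpoly :: "complex^'n^'n \<Rightarrow> complex poly" where
  "charpoly A = det (\<chi> i j. (if i = j then [:0, 1:] else 0) - [:A$i$j:])"

definition linear_part :: "(real^'n \<Rightarrow> real^'n) \<Rightarrow> complex^'n^'n" where
  "linear_part X = (\<chi> i j. complex_of_real (jacobian X (at 0) $ i $ j))"

definition nonzero_eigenvalues_pm_i_double :: "complex^'n^'n \<Rightarrow> real \<Rightarrow> bool" where
  "nonzero_eigenvalues_pm_i_double A \<alpha> \<longleftrightarrow>
     {\<mu>. poly (charpoly A) \<mu> = 0 \<and> \<mu> \<noteq> 0} = {\<i> * of_real \<alpha>, - (\<i> * of_real \<alpha>)} \<and>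
     order (\<i> * of_real \<alpha>) (charpoly A) = 2 \<and> order (- (\<i> * of_real \<alpha>)) (charpoly A) = 2"

definition solution :: "(real^'n \<Rightarrow> real^'n) \<Rightarrow> (real \<Rightarrow> real^'n) \<Rightarrow> bool" where
  "solution X \<gamma> \<longleftrightarrow> (\<forall>t. (\<gamma> has_vector_derivative X (\<gamma> t)) (at t))"

text \<open>The least positive period; a constant curve has none.\<close>

definition has_period :: "(real \<Rightarrow> 'a) \<Rightarrow> real \<Rightarrow> bool" where
  "has_period \<gamma> T \<longleftrightarrow> 0 < T \<and> (\<forall>t. \<gamma> (t + T) = \<gamma> t) \<and>
     (\<forall>S. 0 < S \<and> (\<forall>t. \<gamma> (t + S) = \<gamma> t) \<longrightarrow> T \<le> S)"

text \<open>At \<open>\<sigma> = 0\<close> the family degenerates to an equilibrium.  For \<open>\<sigma>\<close> of a fixed sign,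
  different parameters give different orbits; the end points \<open>0\<close> and \<open>2\<pi>\<close> of the
  \<open>\<lambda>\<close>-interval may give the same orbit, and so may \<open>\<sigma>\<close> and \<open>- \<sigma>\<close>.\<close>

definition periodic_family ::
  "(real^'n \<Rightarrow> real^'n) \<Rightarrow> real \<Rightarrow> (real \<Rightarrow> real \<Rightarrow> real \<Rightarrow> real^'n) \<Rightarrow> (real \<Rightarrow> real \<Rightarrow> real) \<Rightarrow> bool"
where
  "periodic_family X \<epsilon> \<gamma> T \<longleftrightarrow>
     continuous_on ({-\<epsilon><..<\<epsilon>} \<times> {0..2*pi} \<times> UNIV) (\<lambda>(\<sigma>, l, t). \<gamma> \<sigma> l t) \<and>
     (\<forall>\<sigma>\<in>{-\<epsilon><..<\<epsilon>}. \<forall>l\<in>{0..2*pi}. solution X (\<gamma> \<sigma> l)) \<and>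
     (\<forall>\<sigma>\<in>{-\<epsilon><..<\<epsilon>} - {0}. \<forall>l\<in>{0..2*pi}. has_period (\<gamma> \<sigma> l) (T \<sigma> l)) \<and>
     inj_on (\<lambda>(\<sigma>, l). range (\<gamma> \<sigma> l)) ({0<..<\<epsilon>} \<times> {0..<2*pi}) \<and>
     inj_on (\<lambda>(\<sigma>, l). range (\<gamma> \<sigma> l)) ({-\<epsilon><..<0} \<times> {0..<2*pi})"

end

theory Submission
  imports Defs
begin

text \<open>
  The open set consists of all germs of the class whose linear part is elliptic, that is
  \<open>bc - ad + fg - eh < 0\<close>. This is an open condition on the 1-jet. It holds for the linear
  field with Hamiltonian \<open>x\<^sub>1 y\<^sub>3 - y\<^sub>1 x\<^sub>3\<close>, which lies in both classes.
  For such a germ the orbits that start near the origin at certain points of the fixed space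
  \<open>Fix\<close> of the involution \<open>R2\<close> are all periodic, and these starting points leave
  enough freedom for two families with the required parametrization.

  The reason for periodicity is a shooting argument in which energy conservation replaces one of
  the two equations. Write \<open>x = (p, v)\<close> with \<open>v = (x\<^sub>3, y\<^sub>3)\<close>, so that
  \<open>Fix = {v = 0}\<close>. By reversibility, an orbit that meets \<open>Fix\<close> at the times \<open>0\<close> and
  \<open>T\<close> has period \<open>2T\<close> (\<open>fixed_twice_imp_periodic\<close>). The condition \<open>v(T) = 0\<close>
  consists of two equations. The Hamiltonian is constant on \<open>Fix\<close>, hence equal to \<open>H(0)\<close>
  along the whole orbit. Suppose that the \<open>x\<^sub>3\<close>-component of the velocity is the dominant
  one near the point reached at time \<open>T\<close>. Since \<open>\<partial>H/\<partial>y\<^sub>3\<close> is this component,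
  the mean value theorem in direction \<open>y\<^sub>3\<close> shows that \<open>H = H(0)\<close> and
  \<open>x\<^sub>3 = 0\<close> force \<open>y\<^sub>3 = 0\<close> (\<open>fixed_if_energy_0\<close>). So only the
  scalar equation \<open>x\<^sub>3(T) = 0\<close> remains. For a start \<open>s w\<close> with \<open>L w\<close> the unit
  vector of the \<open>x\<^sub>3\<close>-axis, where \<open>L\<close> is the linear part, the component
  \<open>x\<^sub>3(t)/s\<close> is close to \<open>sin (\<alpha> t)/\<alpha>\<close> together with its derivative
  (\<open>orb_near_oscillation\<close>), so its first positive zero exists and tends to
  \<open>\<pi>/\<alpha>\<close>. That the zero is the first one also gives that \<open>2T\<close> is the least period.

  The linear solution is explicit because the Hamiltonian structure makes \<open>L\<^sup>3\<close> equal to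
  \<open>- \<alpha>\<^sup>2 L\<close> (\<open>linearization_cube\<close>), which rests on the symmetry of second
  derivatives (\<open>partials_commute\<close>). To have a flow for all times, the nonlinear part is
  composed with the nearest-point map of a small ball; the resulting field is globally Lipschitz,
  is still reversible, and agrees with the germ on the ball in which the periodic orbits live.
  The flow comes from a contraction in a weighted sup norm (\<open>lipschitz_flow_exists\<close>), and
  one inequality of Gronwall type gives uniqueness, continuous dependence and comparison with the
  linear solution.

  The starting points are \<open>s (u + \<kappa> z)\<close> with \<open>L u\<close> the unit vector above and
  \<open>z\<close> a nonzero fixed vector of the involution in the kernel of \<open>L\<close>. Their orbits are
  pairwise different (\<open>orb_range_inj\<close>), and the two families use disjoint ranges of
  \<open>\<kappa>\<close>.
\<close>

section \<open>Iterated partial derivatives\<close>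

text \<open>Iterated partial derivatives stay folded and are rewritten through the lemmas of this section.\<close>

declare partials.simps(2) [simp del]

lemma UNIV_6: "(UNIV :: 6 set) = {1, 2, 3, 4, 5, 6}"
proof -
  have "i \<in> {1, 2, 3, 4, 5, 6}" for i :: 6
  proof (cases i)
    case (of_int z)
    then have "z \<in> {0, 1, 2, 3, 4, 5}" by auto
    then show ?thesis using of_int by auto
  qed
  then show ?thesis by blast
qed

lemma sum_UNIV_6: "(\<Sum>i\<in>(UNIV :: 6 set). f i) = f 1 + f 2 + f 3 + f 4 + f 5 + f 6"
  unfolding UNIV_6 by (subst sum.insert | simp add: add.assoc)+

lemma forall_6: "(\<forall>i::6. P i) \<longleftrightarrow> P 1 \<and> P 2 \<and> P 3 \<and> P 4 \<and> P 5 \<and> P 6"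
  by (metis UNIV_6 UNIV_I empty_iff insert_iff)

lemma partials_append: "partials (ks @ js) f = partials ks (partials js f)"
  by (induction ks) (auto simp: partials.simps)

lemma partials_cong_open:
  assumes "open V" "\<And>x. x \<in> V \<Longrightarrow> f x = g x" "x \<in> V" "smooth_on V f"
  shows "partials js f x = partials js g x"
  using \<open>x \<in> V\<close>
proof (induction js arbitrary: x)
  case Nil
  then show ?case using assms(2) by simp
next
  case (Cons j js)
  have "frechet_derivative (partials js f) (at x) = frechet_derivative (partials js g) (at x)"
    by (rule frechet_derivative_transform_within_open[OF _ \<open>open V\<close>])
       (use Cons assms(4) in \<open>auto simp: smooth_on_def\<close>)
  then show ?case by (simp add: partials.simps)
qed

lemma smooth_on_cong_open:
  assumes "open V" "\<And>x. x \<in> V \<Longrightarrow> f x = g x" "smooth_on V f"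
  shows "smooth_on V g"
  unfolding smooth_on_def
proof (intro allI ballI)
  fix js x assume x: "x \<in> V"
  have "partials js f differentiable (at x)"
    using assms(3) x by (simp add: smooth_on_def)
  then have "(partials js f has_derivative frechet_derivative (partials js f) (at x)) (at x)"
    by (simp add: frechet_derivative_works)
  then have "(partials js g has_derivative frechet_derivative (partials js f) (at x)) (at x)"
    by (rule has_derivative_transform_within_open[OF _ assms(1) x])
       (use partials_cong_open[OF assms(1,2) _ assms(3)] in blast)
  then show "partials js g differentiable (at x)"
    by (rule differentiableI)
qed

lemma smooth_on_subset: "smooth_on V f \<Longrightarrow> W \<subseteq> V \<Longrightarrow> smooth_on W f"
  by (auto simp: smooth_on_def)

lemma smooth_on_partials: "smooth_on V f \<Longrightarrow> smooth_on V (partials ks f)"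
  unfolding smooth_on_def by (metis partials_append)

text \<open>Splitting off the innermost derivative instead of the outermost one lets smoothness be
  read off from explicit first derivatives.\<close>

lemma smooth_onI_partials:
  assumes "\<And>x. x \<in> V \<Longrightarrow> f differentiable (at x)" "\<And>j. smooth_on V (partials [j] f)"
  shows "smooth_on V f"
  unfolding smooth_on_def
proof (intro allI ballI)
  fix js x assume "x \<in> V"
  then show "partials js f differentiable (at x)"
  proof (cases js rule: rev_cases)
    case (snoc ks j)
    then show ?thesis using assms(2)[of j] \<open>x \<in> V\<close> by (metis partials_append smooth_on_def)
  qed (use assms in auto)
qed

lemma smooth_on_has_derivative:
  fixes f :: "real^'n \<Rightarrow> 'b::real_normed_vector"
  assumes "smooth_on V f" "x \<in> V"
  shows "(f has_derivative (\<lambda>h. \<Sum>j\<in>UNIV. h $ j *\<^sub>R partials [j] f x)) (at x)"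
proof -
  have "f differentiable (at x)"
    using assms unfolding smooth_on_def by (metis partials.simps(1))
  then have D: "(f has_derivative frechet_derivative f (at x)) (at x)"
    by (simp add: frechet_derivative_works)
  have "frechet_derivative f (at x) h = (\<Sum>j\<in>UNIV. h $ j *\<^sub>R partials [j] f x)" for h
  proof -
    have "frechet_derivative f (at x) (\<Sum>j\<in>UNIV. h $ j *\<^sub>R axis j 1)
        = (\<Sum>j\<in>UNIV. h $ j *\<^sub>R frechet_derivative f (at x) (axis j 1))"
      using has_derivative_linear[OF D] by (simp add: linear_sum linear_scale)
    moreover have "(\<Sum>j\<in>UNIV. h $ j *\<^sub>R axis j 1) = h"
      using basis_expansion[of h] by (simp add: scalar_mult_eq_scaleR)
    ultimately show ?thesis by (simp add: partials.simps)
  qed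
  then show ?thesis using D by (metis (no_types, lifting) ext)
qed

lemma smooth_on_continuous_on_partials:
  "smooth_on V f \<Longrightarrow> continuous_on V (partials js f)"
  by (meson continuous_at_imp_continuous_on differentiable_imp_continuous_within smooth_on_def)

text \<open>The two claims are proved by one induction, because differentiating a component of an
  iterated partial derivative requires the differentiability of the whole vector.\<close>

lemma smooth_on_components:
  fixes f :: "real^'n \<Rightarrow> real^'m"
  assumes "open V" and smooth: "\<And>i. smooth_on V (\<lambda>x. f x $ i)"
  shows "smooth_on V f" and "x \<in> V \<Longrightarrow> partials js f x $ i = partials js (\<lambda>x. f x $ i) x"
proof -
  have "partials js f differentiable (at x) \<and> (\<forall>i. partials js f x $ i = partials js (\<lambda>x. f x $ i) x)"
    if "x \<in> V" for js x
    using that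
  proof (induction js arbitrary: x)
    case Nil
    have "(\<lambda>x. f x $ i) differentiable (at x)" for i
      using smooth[of i] Nil unfolding smooth_on_def by (metis partials.simps(1))
    then have "f differentiable (at x)"
      by (subst differentiable_componentwise_within) (auto simp: Basis_vec_def inner_axis)
    then show ?case by simp
  next
    case (Cons j js)
    let ?D = "frechet_derivative (partials js f) (at x)"
    have D: "(partials js f has_derivative ?D) (at x)"
      using Cons by (simp add: frechet_derivative_works)
    have "partials (j # js) f x $ i = partials (j # js) (\<lambda>x. f x $ i) x" if x: "x \<in> V" for i x
    proof -
      let ?D = "frechet_derivative (partials js f) (at x)"
      have D: "(partials js f has_derivative ?D) (at x)"
        using Cons x by (simp add: frechet_derivative_works)
      have "((\<lambda>x. partials js f x $ i) has_derivative (\<lambda>h. ?D h $ i)) (at x)"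
        by (rule bounded_linear.has_derivative[OF bounded_linear_vec_nth D])
      then have "(partials js (\<lambda>x. f x $ i) has_derivative (\<lambda>h. ?D h $ i)) (at x)"
        by (rule has_derivative_transform_within_open[OF _ \<open>open V\<close> x]) (use Cons in auto)
      from frechet_derivative_at[OF this] show ?thesis
        by (metis partials.simps(2))
    qed
    note eq = this
    have "(\<lambda>x. partials (j # js) f x $ i) differentiable (at x)" for i
    proof -
      have "partials (j # js) (\<lambda>x. f x $ i) differentiable (at x)"
        using smooth[of i] Cons.prems unfolding smooth_on_def by blast
      then obtain D' where "(partials (j # js) (\<lambda>x. f x $ i) has_derivative D') (at x)"
        by (auto simp: differentiable_def)
      then have "((\<lambda>x. partials (j # js) f x $ i) has_derivative D') (at x)"
        by (rule has_derivative_transform_within_open[OF _ \<open>open V\<close> Cons.prems]) (metis eq)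
      then show ?thesis by (rule differentiableI)
    qed
    then have "partials (j # js) f differentiable (at x)"
      by (subst differentiable_componentwise_within) (auto simp: Basis_vec_def inner_axis)
    then show ?case using eq Cons.prems by blast
  qed
  then show "smooth_on V f" and "x \<in> V \<Longrightarrow> partials js f x $ i = partials js (\<lambda>x. f x $ i) x"
    by (auto simp: smooth_on_def)
qed

lemma partials_minus:
  assumes "smooth_on V f" "x \<in> V" "open V"
  shows "partials js (\<lambda>x. - f x) x = - partials js f x"
  using \<open>x \<in> V\<close>
proof (induction js arbitrary: x)
  case (Cons j js)
  have "(partials js f has_derivative frechet_derivative (partials js f) (at x)) (at x)"
    using assms(1) Cons.prems by (simp add: smooth_on_def flip: frechet_derivative_works)
  then have "((\<lambda>x. - partials js f x) has_derivative (\<lambda>h. - frechet_derivative (partials js f) (at x) h)) (at x)"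
    by (rule has_derivative_minus)
  then have "(partials js (\<lambda>x. - f x) has_derivative (\<lambda>h. - frechet_derivative (partials js f) (at x) h)) (at x)"
    by (rule has_derivative_transform_within_open[OF _ \<open>open V\<close> Cons.prems]) (use Cons in auto)
  from frechet_derivative_at[OF this] show ?case by (metis partials.simps(2))
qed simp

lemma smooth_on_minus:
  assumes "smooth_on V f" "open V"
  shows "smooth_on V (\<lambda>x. - f x)"
  unfolding smooth_on_def
proof (intro allI ballI)
  fix js x assume x: "x \<in> V"
  have "(\<lambda>x. - partials js f x) differentiable (at x)"
    using assms x by (simp add: smooth_on_def differentiable_minus)
  then obtain D' where "((\<lambda>x. - partials js f x) has_derivative D') (at x)"
    by (auto simp: differentiable_def)
  then have "(partials js (\<lambda>x. - f x) has_derivative D') (at x)"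
    by (rule has_derivative_transform_within_open[OF _ \<open>open V\<close> x]) (simp add: partials_minus[OF assms(1) _ assms(2)])
  then show "partials js (\<lambda>x. - f x) differentiable (at x)" by (rule differentiableI)
qed

lemma linear_smooth_on:
  fixes f :: "real^'n \<Rightarrow> 'b::real_normed_vector"
  assumes "linear f"
  shows "smooth_on V f" and "partials [j] f x = f (axis j 1)"
proof -
  have D: "(f has_derivative f) (at x)" for x
    using assms by (intro linear_imp_has_derivative) 
  have 1: "partials [j] f x = f (axis j 1)" for j x
    using frechet_derivative_at[OF D] by (simp add: partials.simps)
  then show "partials [j] f x = f (axis j 1)" .
  have const: "partials js (\<lambda>x::real^'n. c) = (\<lambda>x. if js = [] then c else 0)" for js and c :: 'b
    by (induction js) (auto simp: partials.simps)
  show "smooth_on V f"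
  proof (rule smooth_onI_partials)
    show "f differentiable (at x)" for x using D by (rule differentiableI)
    show "smooth_on V (partials [j] f)" for j
    proof -
      have "partials [j] f = (\<lambda>x. f (axis j 1))" by (intro ext 1)
      then show ?thesis by (simp add: smooth_on_def const)
    qed
  qed
qed

text \<open>Both mixed derivatives are compared with the second difference of \<open>f\<close> over a square of
  side \<open>h\<close>: applying the mean value theorem first in one direction and then in the other
  expresses it as \<open>h\<^sup>2\<close> times either mixed derivative at a point of the square, and both are
  continuous.\<close>

lemma partials_commute:
  fixes f :: "real^'n \<Rightarrow> real"
  assumes "open V" "a \<in> V" "smooth_on V f"
  shows "partials [i, j] f a = partials [j, i] f a"
proof -
  obtain r where r: "0 < r" "ball a r \<subseteq> V"
    using assms by (meson openE)
  have smooth: "smooth_on (ball a r) f" using assms r smooth_on_subset by blast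
  define p where "p i j s t = a + s *\<^sub>R axis i 1 + t *\<^sub>R axis j (1::real)" for i j :: 'n and s t :: real
  have p_ball: "p i j s t \<in> ball a r" if "\<bar>s\<bar> + \<bar>t\<bar> < r" for i j s t
  proof -
    have "norm (p i j s t - a) \<le> \<bar>s\<bar> + \<bar>t\<bar>"
      unfolding p_def using norm_triangle_ineq[of "s *\<^sub>R axis i (1::real)" "t *\<^sub>R axis j 1"] by (simp add: add.assoc)
    then show ?thesis using that by (simp add: dist_norm norm_minus_commute)
  qed
  have deriv: "((\<lambda>s. g (p i j s t)) has_real_derivative partials [i] g (p i j s t)) (at s)"
    if "smooth_on (ball a r) g" "\<bar>s\<bar> + \<bar>t\<bar> < r" for g :: "real^'n \<Rightarrow> real" and i j s t
  proof -
    have "((\<lambda>s. p i j s t) has_derivative (\<lambda>h. h *\<^sub>R axis i 1)) (at s)"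
      unfolding p_def by (auto intro!: derivative_eq_intros)
    from has_derivative_compose[OF this smooth_on_has_derivative[OF that(1) p_ball[OF that(2)]]]
    have "((\<lambda>s. g (p i j s t)) has_derivative
        (\<lambda>h. \<Sum>k\<in>UNIV. (h *\<^sub>R axis i 1) $ k *\<^sub>R partials [k] g (p i j s t))) (at s)" .
    moreover have "(\<Sum>k\<in>UNIV. (h *\<^sub>R axis i 1) $ k *\<^sub>R partials [k] g (p i j s t))
        = h * partials [i] g (p i j s t)" for h
      
    proof -
      have "(h *\<^sub>R axis i 1) $ k *\<^sub>R c = (if k = i then h * c else 0)" for k :: 'n and c :: real
        by (simp add: axis_def)
      then show ?thesis by (simp)
    qed
    ultimately show ?thesis by (simp add: has_field_derivative_def mult_commute_abs)
  qed
  have p_swap: "p i j s t = p j i t s" for i j s t by (simp add: p_def)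
  have second: "\<exists>s\<in>{0<..<h}. \<exists>t\<in>{0<..<h}.
      f (p i j h h) - f (p i j h 0) - f (p i j 0 h) + f (p i j 0 0) = h * h * partials [j, i] f (p i j s t)"
    if h: "0 < h" "2 * h < r" for h i j
  proof -
    have "((\<lambda>s. f (p i j s h) - f (p i j s 0)) has_real_derivative
        partials [i] f (p i j s h) - partials [i] f (p i j s 0)) (at s)" if "0 \<le> s" "s \<le> h" for s
      using that h by (intro DERIV_diff deriv smooth) auto
    from MVT2[OF h(1) this] obtain s where s: "0 < s" "s < h"
      "f (p i j h h) - f (p i j h 0) - (f (p i j 0 h) - f (p i j 0 0))
        = h * (partials [i] f (p i j s h) - partials [i] f (p i j s 0))" by auto
    have "((\<lambda>t. partials [i] f (p j i t s)) has_real_derivative partials [j, i] f (p j i t s)) (at t)"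
      if "0 \<le> t" "t \<le> h" for t
    proof -
      have "partials [j] (partials [i] f) = partials [j, i] f" by (simp add: partials.simps)
      then show ?thesis
        using deriv[OF smooth_on_partials[OF smooth, of "[i]"], of t s j i] that h s by (metis abs_of_nonneg add_mono_thms_linordered_field(4) le_less_trans less_eq_real_def mult_2)
    qed
    from MVT2[OF h(1) this] obtain t where t: "0 < t" "t < h"
      "partials [i] f (p j i h s) - partials [i] f (p j i 0 s) = h * partials [j, i] f (p j i t s)" by auto
    show ?thesis
      using s t by (intro bexI[of _ s] bexI[of _ t]) (auto simp: p_swap[of j i] algebra_simps)
  qed
  have "((\<lambda>h :: real. 0) \<longlongrightarrow> partials [i, j] f a - partials [j, i] f a) (at_right 0)"
  proof -
    have "\<exists>s t s' t'. s \<in> {0<..<h} \<and> t \<in> {0<..<h} \<and> s' \<in> {0<..<h} \<and> t' \<in> {0<..<h} \<and>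
       partials [i, j] f (p i j s t) = partials [j, i] f (p i j s' t')" if h: "0 < h" "2 * h < r" for h
    proof -
      obtain s t where st: "s \<in> {0<..<h}" "t \<in> {0<..<h}" 
        "f (p i j h h) - f (p i j h 0) - f (p i j 0 h) + f (p i j 0 0) = h * h * partials [j, i] f (p i j s t)"
        using second[OF h] by blast
      obtain s' t' where st': "s' \<in> {0<..<h}" "t' \<in> {0<..<h}" 
        "f (p j i h h) - f (p j i h 0) - f (p j i 0 h) + f (p j i 0 0) = h * h * partials [i, j] f (p j i s' t')"
        using second[OF h] by blast
      have "h * h * partials [j, i] f (p i j s t) = h * h * partials [i, j] f (p i j t' s')"
        using st(3) st'(3) unfolding p_swap[of j i] by linarith
      then have "partials [j, i] f (p i j s t) = partials [i, j] f (p i j t' s')"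
        using h by simp
      then show ?thesis using st(1,2) st'(1,2) by metis
    qed
    then obtain s t s' t' where st: "\<And>h. 0 < h \<Longrightarrow> 2 * h < r \<Longrightarrow> s h \<in> {0<..<h} \<and> t h \<in> {0<..<h} \<and>
       s' h \<in> {0<..<h} \<and> t' h \<in> {0<..<h} \<and>
       partials [i, j] f (p i j (s h) (t h)) = partials [j, i] f (p i j (s' h) (t' h))" by metis
    have ev: "\<forall>\<^sub>F h in at_right (0::real). 0 < h \<and> 2 * h < r"
      unfolding eventually_at_right_field using r(1) by (intro exI[of _ "r / 2"]) auto
    have lim: "((\<lambda>h. partials ks f (p i j (u h) (v h))) \<longlongrightarrow> partials ks f a) (at_right 0)"
      if "\<And>h. 0 < h \<Longrightarrow> 2 * h < r \<Longrightarrow> u h \<in> {0<..<h} \<and> v h \<in> {0<..<h}" for ks u v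
    proof -
      have 0: "(w \<longlongrightarrow> 0) (at_right 0)" if "\<And>h. 0 < h \<Longrightarrow> 2 * h < r \<Longrightarrow> w h \<in> {0<..<h}" for w :: "real \<Rightarrow> real"
        by (rule tendsto_sandwich[where f = "\<lambda>_. 0" and h = "\<lambda>h. h"])
           (use ev that in \<open>auto elim!: eventually_mono simp: less_imp_le\<close>)
      have "((\<lambda>h. p i j (u h) (v h)) \<longlongrightarrow> a + 0 *\<^sub>R axis i 1 + 0 *\<^sub>R axis j 1) (at_right 0)"
        unfolding p_def by (intro tendsto_intros 0) (use that in auto)
      moreover have "isCont (partials ks f) a"
        using smooth_on_continuous_on_partials[OF assms(3)] assms(1,2)
        by (simp add: continuous_on_eq_continuous_at)
      ultimately show ?thesis
        using isCont_tendsto_compose[of a "partials ks f" "\<lambda>h. p i j (u h) (v h)"] by simp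
    qed
    have "((\<lambda>h. partials [i, j] f (p i j (s h) (t h)) - partials [j, i] f (p i j (s' h) (t' h)))
        \<longlongrightarrow> partials [i, j] f a - partials [j, i] f a) (at_right 0)"
      by (intro tendsto_diff lim) (use st in auto)
    then show ?thesis
      by (rule Lim_transform_eventually) (use ev in \<open>auto elim!: eventually_mono dest: st\<close>)
  qed
  then show ?thesis using tendsto_const_iff[of "at_right (0::real)"] by (simp add: tendsto_const_iff)
qed

text \<open>Strict differentiability, in the form used for dynamics: the nonlinear part has an arbitrarily
  small Lipschitz constant on small balls.\<close>

lemma smooth_on_strict_derivative:
  fixes f :: "real^'n \<Rightarrow> 'b::real_normed_vector"
  assumes "open V" "a \<in> V" "smooth_on V f" "0 < \<epsilon>"
  defines "L \<equiv> \<lambda>h. \<Sum>j\<in>UNIV. h $ j *\<^sub>R partials [j] f a"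
  obtains r where "0 < r" "cball a r \<subseteq> V"
    "\<And>x y. x \<in> cball a r \<Longrightarrow> y \<in> cball a r \<Longrightarrow> norm ((f x - L x) - (f y - L y)) \<le> \<epsilon> * norm (x - y)"
proof -
  let ?n = "real CARD('n)"
  have "\<exists>d>0. \<forall>x\<in>ball a d. norm (partials [j] f x - partials [j] f a) < \<epsilon> / ?n" for j
  proof -
    have "isCont (partials [j] f) a"
      using smooth_on_continuous_on_partials[OF assms(3)] assms(1,2)
        by (simp add: continuous_on_eq_continuous_at)
    moreover have "0 < \<epsilon> / ?n" using \<open>0 < \<epsilon>\<close> by simp
    ultimately show ?thesis
      unfolding continuous_at_eps_delta by (metis dist_commute dist_norm mem_ball)
  qed
  then obtain d where d: "\<And>j. 0 < d j" "\<And>j x. x \<in> ball a (d j) \<Longrightarrow> norm (partials [j] f x - partials [j] f a) < \<epsilon> / ?n"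
    by metis
  obtain r0 where r0: "0 < r0" "ball a r0 \<subseteq> V" using assms openE by blast
  define r where "r = min r0 (Min (range d)) / 2"
  have "0 < Min (range d)"
    using d(1) by simp
  then have r: "0 < r" "r < r0"
    using r0(1) unfolding r_def by linarith+
  have r_d: "r < d j" for j
  proof -
    have "Min (range d) \<le> d j" by simp
    with \<open>0 < Min (range d)\<close> show ?thesis
      using r0(1) unfolding r_def by linarith
  qed
  have linL: "linear L"
    unfolding L_def by (intro linearI) (simp_all add: sum.distrib scaleR_add_left scaleR_sum_right)
  show thesis
  proof
    show "0 < r" by fact
    show "cball a r \<subseteq> V" using r r0 by auto
    fix x y assume xy: "x \<in> cball a r" "y \<in> cball a r"
    show "norm ((f x - L x) - (f y - L y)) \<le> \<epsilon> * norm (x - y)"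
    proof (rule differentiable_bound[where S = "cball a r"])
      fix z assume z: "z \<in> cball a r"
      then have "z \<in> V" using r r0 by auto
      have "((\<lambda>x. f x - L x) has_derivative
          (\<lambda>h. (\<Sum>j\<in>UNIV. h $ j *\<^sub>R partials [j] f z) - L h)) (at z within cball a r)"
        by (intro has_derivative_diff has_derivative_at_withinI[OF smooth_on_has_derivative[OF assms(3) \<open>z \<in> V\<close>]]
              linear_imp_has_derivative linL)
      moreover have "(\<Sum>j\<in>UNIV. h $ j *\<^sub>R partials [j] f z) - L h
          = (\<Sum>j\<in>UNIV. h $ j *\<^sub>R (partials [j] f z - partials [j] f a))" for h
        by (simp add: L_def scaleR_diff_right sum_subtractf)
      ultimately show "((\<lambda>x. f x - L x) has_derivative
          (\<lambda>h. \<Sum>j\<in>UNIV. h $ j *\<^sub>R (partials [j] f z - partials [j] f a))) (at z within cball a r)"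
        by simp
      show "onorm (\<lambda>h. \<Sum>j\<in>UNIV. h $ j *\<^sub>R (partials [j] f z - partials [j] f a)) \<le> \<epsilon>"
      proof (rule onorm_bound)
        show "0 \<le> \<epsilon>" using \<open>0 < \<epsilon>\<close> by simp
        fix h :: "real^'n"
        have "norm (\<Sum>j\<in>UNIV. h $ j *\<^sub>R (partials [j] f z - partials [j] f a))
            \<le> (\<Sum>j\<in>(UNIV::'n set). norm h * (\<epsilon> / ?n))"
        proof (intro sum_norm_le)
          fix j
          have "z \<in> ball a (d j)" using z r_d[of j] by auto
          then have "norm (partials [j] f z - partials [j] f a) \<le> \<epsilon> / ?n"
            using d(2) less_imp_le by blast
          then show "norm (h $ j *\<^sub>R (partials [j] f z - partials [j] f a)) \<le> norm h * (\<epsilon> / ?n)"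
            unfolding norm_scaleR using component_le_norm_cart[of h j] \<open>0 < \<epsilon>\<close>
            by (intro mult_mono) auto
        qed
        then show "norm (\<Sum>j\<in>UNIV. h $ j *\<^sub>R (partials [j] f z - partials [j] f a)) \<le> \<epsilon> * norm h"
          by (simp add: mult.commute)
      qed
    qed (use xy in auto)
  qed
qed

section \<open>Flows of Lipschitz vector fields\<close>

text \<open>Working with the square of the norm avoids its non-differentiability at zero. The mixed term
  \<open>2 c |d|\<close> is absorbed by \<open>|d|\<^sup>2 + c\<^sup>2\<close>, which explains the rate \<open>2 K + 1\<close>.\<close>

lemma gronwall_forward:
  fixes d :: "real \<Rightarrow> 'a::real_inner"
  assumes "0 \<le> b" "0 \<le> K" "0 \<le> c"
    and der: "\<And>t. 0 \<le> t \<Longrightarrow> t \<le> b \<Longrightarrow> (d has_vector_derivative d' t) (at t)"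
    and bound: "\<And>t. 0 \<le> t \<Longrightarrow> t \<le> b \<Longrightarrow> norm (d' t) \<le> K * norm (d t) + c"
  shows "(norm (d b))\<^sup>2 \<le> ((norm (d 0))\<^sup>2 + c\<^sup>2 * b) * exp ((2 * K + 1) * b)"
proof -
  define g where "g t = (norm (d t))\<^sup>2 * exp (- (2 * K + 1) * t) - c\<^sup>2 * t" for t
  have "g b \<le> g 0"
  proof (rule DERIV_nonpos_imp_nonincreasing[OF \<open>0 \<le> b\<close>])
    fix t assume t: "0 \<le> t" "t \<le> b"
    let ?e = "exp (- (2 * K + 1) * t)"
    let ?g' = "(2 * (d t \<bullet> d' t) - (2 * K + 1) * (norm (d t))\<^sup>2) * ?e - c\<^sup>2"
    have dd: "((\<lambda>t. d t \<bullet> d t) has_field_derivative 2 * (d t \<bullet> d' t)) (at t)"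
      unfolding has_field_derivative_def
      by (rule derivative_eq_intros der[OF t, unfolded has_vector_derivative_def]
          | simp add: inner_commute fun_eq_iff)+
    have 1: "(g has_field_derivative ?g') (at t)"
      unfolding g_def power2_norm_eq_inner
      by (auto intro!: derivative_eq_intros dd simp: algebra_simps)
    have "d t \<bullet> d' t \<le> norm (d t) * norm (d' t)"
      by (rule norm_cauchy_schwarz)
    also have "\<dots> \<le> norm (d t) * (K * norm (d t) + c)"
      by (intro mult_left_mono bound t) auto
    finally have "2 * (d t \<bullet> d' t) \<le> 2 * K * (norm (d t))\<^sup>2 + 2 * (norm (d t) * c)"
      by (simp add: algebra_simps power2_eq_square)
    also have "2 * (norm (d t) * c) \<le> (norm (d t))\<^sup>2 + c\<^sup>2"
      using sum_squares_bound[of "norm (d t)" c] by simp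
    finally have "2 * (d t \<bullet> d' t) - (2 * K + 1) * (norm (d t))\<^sup>2 \<le> c\<^sup>2"
      by (simp add: algebra_simps)
    then have "(2 * (d t \<bullet> d' t) - (2 * K + 1) * (norm (d t))\<^sup>2) * ?e \<le> c\<^sup>2 * ?e"
      by (rule mult_right_mono) simp
    also have "\<dots> \<le> c\<^sup>2 * 1"
      using assms t by (intro mult_left_mono) (auto intro!: mult_nonpos_nonneg)
    finally have "?g' \<le> 0" by simp
    with 1 show "\<exists>y. (g has_real_derivative y) (at t) \<and> y \<le> 0" by blast
  qed
  then have "(norm (d b))\<^sup>2 * exp (- (2 * K + 1) * b) \<le> (norm (d 0))\<^sup>2 + c\<^sup>2 * b"
    by (simp add: g_def)
  then have "(norm (d b))\<^sup>2 * exp (- (2 * K + 1) * b) * exp ((2 * K + 1) * b)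
      \<le> ((norm (d 0))\<^sup>2 + c\<^sup>2 * b) * exp ((2 * K + 1) * b)"
    by (rule mult_right_mono) simp
  moreover have "exp (- (2 * K + 1) * b) * exp ((2 * K + 1) * b) = 1"
    by (simp flip: exp_add add: algebra_simps)
  ultimately show ?thesis by (simp only: mult.assoc mult_1_right)
qed

lemma gronwall:
  fixes d :: "real \<Rightarrow> 'a::real_inner"
  assumes "0 \<le> K" "0 \<le> c"
    and der: "\<And>t. (d has_vector_derivative d' t) (at t)"
    and bound: "\<And>t. norm (d' t) \<le> K * norm (d t) + c"
  shows "(norm (d t))\<^sup>2 \<le> ((norm (d 0))\<^sup>2 + c\<^sup>2 * \<bar>t\<bar>) * exp ((2 * K + 1) * \<bar>t\<bar>)"
proof (cases "0 \<le> t")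
  case True
  then show ?thesis using gronwall_forward[of t K c d d'] assms by auto
next
  case False
  have "((\<lambda>t. d (- t)) has_vector_derivative - d' (- t)) (at t)" for t
  proof -
    have "(uminus has_vector_derivative (- 1 :: real)) (at t)"
      by (auto intro!: derivative_eq_intros)
    from vector_diff_chain_at[OF this der] show ?thesis by (simp add: o_def)
  qed
  then show ?thesis
    using gronwall_forward[of "- t" K c "\<lambda>t. d (- t)" "\<lambda>t. - d' (- t)"] assms False by auto
qed

text \<open>At most one of the two integrals is over a nondegenerate interval, so this is the integral from
  \<open>0\<close> to \<open>t\<close> with its orientation.\<close>

definition antiderivative :: "(real \<Rightarrow> 'a::banach) \<Rightarrow> real \<Rightarrow> 'a" where
  "antiderivative g t = integral {0..t} g - integral {t..0} g"

lemma antiderivative_0 [simp]: "antiderivative g 0 = 0"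
  by (simp add: antiderivative_def)

lemma has_vector_derivative_antiderivative:
  assumes "continuous_on UNIV g"
  shows "(antiderivative g has_vector_derivative g t) (at t)"
proof -
  define b where "b = \<bar>t\<bar> + 1"
  have int: "g integrable_on {u..v}" for u v
    by (rule integrable_continuous_real) (use assms continuous_on_subset in blast)
  have eq: "integral {- b..u} g - integral {- b..0} g = antiderivative g u" if "u \<in> {- b<..<b}" for u
  proof (cases "0 \<le> u")
    case True
    then show ?thesis
      using Henstock_Kurzweil_Integration.integral_combine[of "- b" 0 u g] int that
      by (cases "u = 0") (auto simp: antiderivative_def algebra_simps)
  next
    case False
    then show ?thesis
      using Henstock_Kurzweil_Integration.integral_combine[of "- b" u 0 g] int that
      by (auto simp: antiderivative_def algebra_simps)
  qed
  have "((\<lambda>u. integral {- b..u} g) has_vector_derivative g t) (at t within {- b..b})"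
    by (rule integral_has_vector_derivative) (use assms continuous_on_subset in \<open>auto simp: b_def\<close>)
  then have "((\<lambda>u. integral {- b..u} g) has_vector_derivative g t) (at t)"
    by (subst (asm) at_within_interior) (auto simp: b_def)
  then have "((\<lambda>u. integral {- b..u} g - integral {- b..0} g) has_vector_derivative g t) (at t)"
    by (auto intro!: derivative_eq_intros)
  then show ?thesis
    by (rule has_vector_derivative_transform_within_open[where S = "{- b<..<b}"])
       (auto simp: eq, auto simp: b_def)
qed

lemma norm_antiderivative_le:
  fixes g :: "real \<Rightarrow> 'a::banach"
  assumes "continuous_on UNIV g" "0 < M" and le: "\<And>s. norm (g s) \<le> C * exp (M * \<bar>s\<bar>)"
  shows "norm (antiderivative g t) \<le> C / M * (exp (M * \<bar>t\<bar>) - 1)"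
proof -
  have int: "g integrable_on {u..v}" for u v
    by (rule integrable_continuous_real) (use assms continuous_on_subset in blast)
  show ?thesis
  proof (cases "0 \<le> t")
    case True
    have I: "((\<lambda>s. C * exp (M * s)) has_integral (C / M * exp (M * t) - C / M * exp (M * 0))) {0..t}"
      using \<open>0 < M\<close> True
      by (intro fundamental_theorem_of_calculus)
         (auto intro!: derivative_eq_intros simp: has_real_derivative_iff_has_vector_derivative[symmetric])
    have "norm (g s) \<le> C * exp (M * s)" if "s \<in> {0..t}" for s
      using le[of s] that by simp
    with I have "norm (integral {0..t} g) \<le> integral {0..t} (\<lambda>s. C * exp (M * s))"
      by (intro integral_norm_bound_integral[OF int]) auto
    then show ?thesis
      using True integral_unique[OF I] by (cases "t = 0") (auto simp: antiderivative_def algebra_simps)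
  next
    case False
    have I: "((\<lambda>s. C * exp (- M * s)) has_integral (- C / M * exp (- M * 0) - (- C / M * exp (- M * t)))) {t..0}"
      using \<open>0 < M\<close> False
      by (intro fundamental_theorem_of_calculus)
         (auto intro!: derivative_eq_intros simp: has_real_derivative_iff_has_vector_derivative[symmetric])
    have "norm (g s) \<le> C * exp (- M * s)" if "s \<in> {t..0}" for s
      using le[of s] that by simp
    with I have "norm (integral {t..0} g) \<le> integral {t..0} (\<lambda>s. C * exp (- M * s))"
      by (intro integral_norm_bound_integral[OF int]) auto
    then show ?thesis
      using False integral_unique[OF I] by (auto simp: antiderivative_def algebra_simps)
  qed
qed

text \<open>Picard iteration becomes a contraction on the whole line after division by
  \<open>exp (2 K |t|)\<close>: integrating a function bounded by \<open>K exp (2 K |t|)\<close> gains the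
  factor \<open>1/2\<close>. The fixed point equation is solved for the bounded continuous quotient.\<close>

theorem lipschitz_flow_exists:
  fixes F :: "'a::euclidean_space \<Rightarrow> 'a"
  assumes "0 < K" and lip: "\<And>x y. norm (F x - F y) \<le> K * norm (x - y)"
    and "F 0 = 0"
  shows "\<exists>\<psi>. \<forall>x. \<psi> x 0 = x \<and> (\<forall>t. (\<psi> x has_vector_derivative F (\<psi> x t)) (at t))"
proof -
  have "\<exists>y. y 0 = x \<and> (\<forall>t. (y has_vector_derivative F (y t)) (at t))" for x
  proof -
    \<comment> \<open>The weight; the solution is sought as \<open>e t\<close> times a bounded function.\<close>
    define e where "e t = exp (2 * K * \<bar>t\<bar>)" for t :: real
    have e_pos: "0 < e t" "1 \<le> e t" for t
      using \<open>0 < K\<close> by (auto simp: e_def)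
    have contF: "continuous_on UNIV F"
      unfolding continuous_on_iff dist_norm
    proof (intro ballI allI impI)
      fix x :: 'a and \<epsilon> :: real assume "0 < \<epsilon>"
      show "\<exists>d>0. \<forall>x'\<in>UNIV. norm (x' - x) < d \<longrightarrow> norm (F x' - F x) < \<epsilon>"
      proof (intro exI[of _ "\<epsilon> / K"] conjI ballI impI)
        fix x' assume "norm (x' - x) < \<epsilon> / K"
        then show "norm (F x' - F x) < \<epsilon>"
          using lip[of x' x] \<open>0 < K\<close> by (simp add: field_simps)
      qed (use \<open>0 < \<epsilon>\<close> \<open>0 < K\<close> in auto)
    qed
    define G where "G w s = F (e s *\<^sub>R apply_bcontfun w s)" for w :: "real \<Rightarrow>\<^sub>C 'a" and s
    have contG: "continuous_on UNIV (G w)" for w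
      unfolding G_def e_def
      by (rule continuous_on_compose2[OF contF]) (auto intro!: continuous_intros)
    have G_diff: "norm (G v s - G w s) \<le> K * dist v w * e s" for v w s
    proof -
      have "norm (G v s - G w s) \<le> K * norm (e s *\<^sub>R (apply_bcontfun v s - apply_bcontfun w s))"
        unfolding G_def by (metis lip scaleR_diff_right)
      also have "\<dots> = K * (e s * dist (apply_bcontfun v s) (apply_bcontfun w s))"
        using e_pos(1)[of s] by (simp add: dist_norm)
      also have "\<dots> \<le> K * (e s * dist v w)"
        using \<open>0 < K\<close> e_pos(1)[of s] by (intro mult_left_mono dist_bounded) auto
      finally show ?thesis by (simp add: mult_ac)
    qed
    have G0: "G 0 = (\<lambda>_. 0)"
      by (simp add: G_def \<open>F 0 = 0\<close> fun_eq_iff)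
    have anti: "norm (antiderivative (G v) t - antiderivative (G w) t) \<le> dist v w / 2 * (e t - 1)"
      for v w t
    proof -
      have int: "G w integrable_on {u..v}" for u v w
        by (rule integrable_continuous_real) (use contG continuous_on_subset in blast)
      have "antiderivative (G v) t - antiderivative (G w) t = antiderivative (\<lambda>s. G v s - G w s) t"
        using int by (simp add: antiderivative_def Henstock_Kurzweil_Integration.integral_diff)
      moreover have "norm (antiderivative (\<lambda>s. G v s - G w s) t)
          \<le> (K * dist v w) / (2 * K) * (exp (2 * K * \<bar>t\<bar>) - 1)"
        using \<open>0 < K\<close> G_diff contG
        by (intro norm_antiderivative_le) (auto simp: e_def intro!: continuous_intros)
      ultimately show ?thesis using \<open>0 < K\<close> by (simp add: e_def)
    qed
    define P where "P w t = (1 / e t) *\<^sub>R (x + antiderivative (G w) t)" for w t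
    have "P w \<in> bcontfun" for w
    proof (rule bcontfun_normI)
      have "continuous_on UNIV (antiderivative (G w))"
        by (rule continuous_at_imp_continuous_on)
           (use has_vector_derivative_antiderivative[OF contG] has_vector_derivative_continuous in blast)
      then show "continuous_on UNIV (P w)"
        unfolding P_def e_def by (auto intro!: continuous_intros)
      fix t
      have "antiderivative (G 0) t = 0"
        using anti[where v = 0 and w = 0 and t = t] by (simp add: antiderivative_def G0)
      then have "norm (antiderivative (G w) t) \<le> dist w 0 / 2 * (e t - 1)"
        using anti[where v = w and w = 0 and t = t] by simp
      also have "\<dots> \<le> dist w 0 / 2 * e t"
        by (intro mult_left_mono) auto
      finally have A: "norm (antiderivative (G w) t) \<le> dist w 0 / 2 * e t" .
      have "norm (x + antiderivative (G w) t) \<le> norm x + dist w 0 / 2 * e t"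
        using A norm_triangle_ineq[of x "antiderivative (G w) t"] by linarith
      also have "\<dots> \<le> (norm x + dist w 0 / 2) * e t"
        using e_pos[of t] mult_left_mono[of 1 "e t" "norm x"] by (simp add: algebra_simps)
      finally have "norm (x + antiderivative (G w) t) / e t \<le> norm x + dist w 0 / 2"
        using e_pos[of t] by (simp only: pos_divide_le_eq)
      then show "norm (P w t) \<le> norm x + dist w 0 / 2"
        using e_pos[of t] by (simp add: P_def del: scaleR_add_right)
    qed
    then have P: "apply_bcontfun (Bcontfun (P w)) = P w" for w
      by (simp add: Bcontfun_inverse)
    have "dist (Bcontfun (P v)) (Bcontfun (P w)) \<le> 1 / 2 * dist v w" for v w
    proof (rule dist_bound)
      fix t
      have "P v t - P w t = (1 / e t) *\<^sub>R (antiderivative (G v) t - antiderivative (G w) t)"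
        by (simp add: P_def algebra_simps)
      then have "norm (P v t - P w t) \<le> (1 / e t) * (dist v w / 2 * (e t - 1))"
        using mult_left_mono[OF anti[where t = t and v = v and w = w], of "1 / e t"] e_pos[of t] by simp
      also have "\<dots> \<le> 1 / 2 * dist v w"
        using e_pos[of t] by (simp add: field_simps)
      finally show "dist (apply_bcontfun (Bcontfun (P v)) t) (apply_bcontfun (Bcontfun (P w)) t)
          \<le> 1 / 2 * dist v w"
        by (simp add: P dist_norm)
    qed
    then have "\<exists>!w. Bcontfun (P w) = w"
      by (intro banach_fix_type[of "1 / 2"]) auto
    then obtain w where "Bcontfun (P w) = w" by blast
    then have w: "apply_bcontfun w t = P w t" for t by (metis P)
    define y where "y t = x + antiderivative (G w) t" for t
    have y: "y t = e t *\<^sub>R apply_bcontfun w t" for t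
      using e_pos[of t] by (simp add: w P_def y_def)
    have "(y has_vector_derivative G w t) (at t)" for t
      unfolding y_def by (auto intro!: derivative_eq_intros has_vector_derivative_antiderivative contG)
    then have "(y has_vector_derivative F (y t)) (at t)" for t
      by (simp add: y G_def)
    moreover have "y 0 = x" by (simp add: y_def)
    ultimately show ?thesis by blast
  qed
  then show ?thesis by metis
qed

locale lipschitz_flow =
  fixes F :: "'a::euclidean_space \<Rightarrow> 'a" and K :: real and \<psi> :: "'a \<Rightarrow> real \<Rightarrow> 'a"
  assumes K_pos: "0 < K"
    and lipschitz: "norm (F x - F y) \<le> K * norm (x - y)"
    and F_0: "F 0 = 0"
    and start: "\<psi> x 0 = x"
    and flow: "(\<psi> x has_vector_derivative F (\<psi> x t)) (at t)"
begin

lemma solutions_close: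
  assumes y: "\<And>t. (y has_vector_derivative F (y t)) (at t)"
    and z: "\<And>t. (z has_vector_derivative F (z t)) (at t)"
  shows "norm (y t - z t) \<le> norm (y 0 - z 0) * exp ((K + 1 / 2) * \<bar>t\<bar>)"
proof -
  have "(norm (y t - z t))\<^sup>2 \<le> ((norm (y 0 - z 0))\<^sup>2 + 0\<^sup>2 * \<bar>t\<bar>) * exp ((2 * K + 1) * \<bar>t\<bar>)"
  proof (rule gronwall[of K 0 "\<lambda>t. y t - z t" "\<lambda>t. F (y t) - F (z t)"])
    show "((\<lambda>t. y t - z t) has_vector_derivative F (y t) - F (z t)) (at t)" for t
      by (intro has_vector_derivative_diff y z)
  qed (use K_pos lipschitz in auto)
  also have "\<dots> = (norm (y 0 - z 0) * exp ((K + 1 / 2) * \<bar>t\<bar>))\<^sup>2"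
    by (simp add: power_mult_distrib algebra_simps flip: exp_double)
  finally show ?thesis by (rule power2_le_imp_le) simp
qed

lemma flow_unique:
  assumes "\<And>t. (y has_vector_derivative F (y t)) (at t)" "y 0 = x"
  shows "y t = \<psi> x t"
  using solutions_close[of y "\<psi> x" t] assms flow by (simp add: start)

lemma flow_shift: "\<psi> x (t + T) = \<psi> (\<psi> x T) t"
proof (rule flow_unique[where y = "\<lambda>t. \<psi> x (t + T)"])
  show "((\<lambda>t. \<psi> x (t + T)) has_vector_derivative F (\<psi> x (t + T))) (at t)" for t
    using vector_diff_chain_at[of "\<lambda>t. t + T" 1 t "\<psi> x", OF _ flow]
    by (simp add: o_def has_vector_derivative_add_const)
qed simp

lemma flow_0: "\<psi> 0 t = 0"
  using flow_unique[of "\<lambda>_. 0" 0 t] by (simp add: F_0)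

lemma norm_flow_le: "norm (\<psi> x t) \<le> norm x * exp ((K + 1 / 2) * \<bar>t\<bar>)"
  using solutions_close[of "\<psi> x" "\<psi> 0" t, OF flow flow] by (simp add: start flow_0)

lemma continuous_on_flow: "continuous_on UNIV (\<lambda>(x, t). \<psi> x t)"
proof -
  have "((\<lambda>(x, t). \<psi> x t) \<longlongrightarrow> \<psi> x0 t0) (at (x0, t0))" for x0 t0
  proof -
    have 1: "((\<lambda>p. norm (fst p - x0) * exp ((K + 1 / 2) * \<bar>snd p\<bar>)) \<longlongrightarrow>
        norm (fst (x0, t0) - x0) * exp ((K + 1 / 2) * \<bar>snd (x0, t0)\<bar>)) (at (x0, t0))"
      by (intro tendsto_intros)
    have "((\<lambda>p. \<psi> (fst p) (snd p) - \<psi> x0 (snd p)) \<longlongrightarrow> 0) (at (x0, t0))"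
      by (rule Lim_null_comparison[OF _ tendsto_eq_rhs[OF 1]])
         (use solutions_close[OF flow flow] in \<open>auto simp: start\<close>)
    moreover have "isCont (\<psi> x0) t0"
      using flow has_vector_derivative_continuous by blast
    then have "((\<lambda>p. \<psi> x0 (snd p)) \<longlongrightarrow> \<psi> x0 (snd (x0, t0))) (at (x0, t0))"
      by (intro isCont_tendsto_compose[of _ "\<psi> x0"] tendsto_intros) simp
    ultimately have "((\<lambda>p. (\<psi> (fst p) (snd p) - \<psi> x0 (snd p)) + \<psi> x0 (snd p)) \<longlongrightarrow> 0 + \<psi> x0 t0) (at (x0, t0))"
      by (intro tendsto_add) simp_all
    then show ?thesis by (simp add: case_prod_unfold)
  qed
  then show ?thesis
    by (auto simp: continuous_on_eq_continuous_at isCont_def)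
qed

end

section \<open>The linear part of a reversible Hamiltonian vector field\<close>

lemma R2_nth [simp]:
  "R2 x $ 1 = x $ 1" "R2 x $ 2 = x $ 2" "R2 x $ 3 = x $ 3" "R2 x $ 4 = x $ 4"
  "R2 x $ 5 = - (x $ 5)" "R2 x $ 6 = - (x $ 6)"
  by (simp_all add: R2_def vector_6_nth)

lemma ham_vf_nth:
  "ham_vf H x $ 1 = partials [2] H x" "ham_vf H x $ 2 = - partials [1] H x"
  "ham_vf H x $ 3 = partials [4] H x" "ham_vf H x $ 4 = - partials [3] H x"
  "ham_vf H x $ 5 = partials [6] H x" "ham_vf H x $ 6 = - partials [5] H x"
  unfolding ham_vf_def by (rule vector_6_nth)+

lemma linear_R2: "linear R2"
  by (rule linearI) (simp_all add: vec_eq_iff forall_6)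

lemma R2_R2 [simp]: "R2 (R2 x) = x"
  by (simp add: vec_eq_iff forall_6)

lemma norm_R2 [simp]: "norm (R2 x) = norm x"
  by (simp add: norm_vec_def L2_set_def sum_UNIV_6)

lemma R2_fixed_iff: "R2 x = x \<longleftrightarrow> x $ 5 = 0 \<and> x $ 6 = 0"
  by (auto simp: vec_eq_iff forall_6)

lemma smooth_on_ham_vf:
  assumes "open V" "smooth_on V H"
  shows "smooth_on V (ham_vf H)"
proof (rule smooth_on_components(1)[OF \<open>open V\<close>])
  have "\<forall>i. smooth_on V (\<lambda>x. ham_vf H x $ i)"
    unfolding forall_6 ham_vf_nth
    by (intro conjI smooth_on_minus smooth_on_partials assms)
  then show "smooth_on V (\<lambda>x. ham_vf H x $ i)" for i by blast
qed

lemma Omega2_representative: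
  assumes "X \<in> Omega2"
  obtains H r where "0 < r" "smooth_on (ball 0 r) H" "smooth_on (ball 0 r) X"
    "\<And>x. x \<in> ball 0 r \<Longrightarrow> X x = ham_vf H x" "\<And>x. x \<in> ball 0 r \<Longrightarrow> X (R2 x) = - R2 (X x)"
proof -
  obtain H V where H: "open V" "0 \<in> V" "smooth_on V H" "\<forall>\<^sub>F x in nhds 0. X x = ham_vf H x"
    "\<forall>\<^sub>F x in nhds 0. X (R2 x) = - R2 (X x)"
    using assms by (auto simp: Omega2_def is_hamiltonian_of_def smooth_germ_def)
  have "\<forall>\<^sub>F x in nhds 0. x \<in> V \<and> X x = ham_vf H x \<and> X (R2 x) = - R2 (X x)"
    using H by (auto intro!: eventually_conj eventually_nhds_in_open)
  then obtain r where r: "0 < r" "\<And>x. x \<in> ball 0 r \<Longrightarrow> x \<in> V \<and> X x = ham_vf H x \<and> X (R2 x) = - R2 (X x)"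
    by (auto simp: eventually_nhds_metric dist_commute)
  have "smooth_on (ball 0 r) H"
    by (rule smooth_on_subset[OF H(3)]) (use r in auto)
  moreover have "smooth_on (ball 0 r) X"
    by (rule smooth_on_cong_open[where f = "ham_vf H"])
       (use r smooth_on_ham_vf[OF _ calculation] in auto)
  ultimately show thesis using that r by blast
qed

definition entry :: "(real^6 \<Rightarrow> real^6) \<Rightarrow> 6 \<Rightarrow> 6 \<Rightarrow> real" where
  "entry X i j = partials [j] X 0 $ i"

text \<open>The number \<open>bc - ad + fg - eh\<close>; for a reversible Hamiltonian field with nonzero discriminant, its
  square roots are the nonzero eigenvalues of the linear part.\<close>

definition discriminant :: "(real^6 \<Rightarrow> real^6) \<Rightarrow> real" where
  "discriminant X = entry X 1 6 * entry X 2 5 - entry X 1 5 * entry X 2 6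
     + entry X 3 6 * entry X 4 5 - entry X 3 5 * entry X 4 6"

definition linearization :: "(real^6 \<Rightarrow> real^6) \<Rightarrow> real^6 \<Rightarrow> real^6" where
  "linearization X h = (\<Sum>j\<in>UNIV. h $ j *\<^sub>R partials [j] X 0)"

lemma linear_linearization: "linear (linearization X)"
  unfolding linearization_def by (intro linearI) (simp_all add: sum.distrib scaleR_add_left scaleR_sum_right)

lemma linearization_axis: "linearization X (axis j 1) $ i = entry X i j"
proof -
  have "(axis j 1 :: real^6) $ k *\<^sub>R v = (if k = j then v else 0)" for k and v :: "real^6"
    by (simp add: axis_def)
  then show ?thesis by (simp add: linearization_def entry_def)
qed

lemma linearization_R2:
  assumes "X \<in> Omega2"
  shows "linearization X (R2 h) = - R2 (linearization X h)"
proof -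
  obtain H r where r: "0 < r" "smooth_on (ball 0 r) X" "\<And>x. x \<in> ball 0 r \<Longrightarrow> X (R2 x) = - R2 (X x)"
    using Omega2_representative[OF assms] by metis
  have D: "(X has_derivative linearization X) (at 0)"
    using smooth_on_has_derivative[OF r(2), of 0] r(1) by (simp add: linearization_def[abs_def])
  have R: "(R2 has_derivative R2) (at x)" for x
    by (rule linear_imp_has_derivative[OF linear_R2])
  have "R2 0 = 0" using linear_R2 by (rule linear_0)
  then have "((\<lambda>x. X (R2 x)) has_derivative (\<lambda>h. linearization X (R2 h))) (at 0)"
    using has_derivative_compose[OF R[of 0]] D by simp
  moreover have "((\<lambda>x. - R2 (X x)) has_derivative (\<lambda>h. - R2 (linearization X h))) (at 0)"
    by (intro has_derivative_minus has_derivative_compose[OF D R])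
  then have "((\<lambda>x. X (R2 x)) has_derivative (\<lambda>h. - R2 (linearization X h))) (at 0)"
    by (rule has_derivative_transform_within_open[OF _ open_ball[of 0 r]]) (use r in auto)
  ultimately show ?thesis by (metis has_derivative_unique)
qed

text \<open>Reversibility makes the two diagonal blocks vanish. The relations between the off-diagonal
  blocks are the symmetry of the Hessian of the Hamiltonian, up to the signs of the symplectic form.\<close>

lemma entries_Omega2:
  assumes "X \<in> Omega2"
  shows "i \<in> {1, 2, 3, 4} \<Longrightarrow> j \<in> {1, 2, 3, 4} \<Longrightarrow> entry X i j = 0"
    and "i \<in> {5, 6} \<Longrightarrow> j \<in> {5, 6} \<Longrightarrow> entry X i j = 0"
    and "entry X 5 1 = - entry X 2 6" "entry X 5 2 = entry X 1 6"
    and "entry X 5 3 = - entry X 4 6" "entry X 5 4 = entry X 3 6"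
    and "entry X 6 1 = entry X 2 5" "entry X 6 2 = - entry X 1 5"
    and "entry X 6 3 = entry X 4 5" "entry X 6 4 = - entry X 3 5"
proof -
  have axis: "R2 (axis j 1) = axis j 1" if "j \<in> {1, 2, 3, 4}" for j
    using that by (auto simp: R2_fixed_iff axis_def)
  have axis': "R2 (axis j 1) = - axis j 1" if "j \<in> {5, 6}" for j
    using that by (auto simp: vec_eq_iff forall_6 axis_def)
  show "entry X i j = 0" if "i \<in> {1, 2, 3, 4}" "j \<in> {1, 2, 3, 4}" for i j
  proof -
    have "linearization X (axis j 1) $ i = (- R2 (linearization X (axis j 1))) $ i"
      using linearization_R2[OF assms, of "axis j 1"] unfolding axis[OF that(2)] by (rule arg_cong)
    then show ?thesis using that(1) by (auto simp: linearization_axis)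
  qed
  show "entry X i j = 0" if "i \<in> {5, 6}" "j \<in> {5, 6}" for i j
  proof -
    have "(- linearization X (axis j 1)) $ i = (- R2 (linearization X (axis j 1))) $ i"
      using linearization_R2[OF assms, of "axis j 1"]
      unfolding axis'[OF that(2)] linear_neg[OF linear_linearization] by (rule arg_cong)
    then show ?thesis using that(1) by (auto simp: linearization_axis)
  qed
  obtain H r where H: "0 < r" "smooth_on (ball 0 r) H" "smooth_on (ball 0 r) X"
    "\<And>x. x \<in> ball 0 r \<Longrightarrow> X x = ham_vf H x"
    using Omega2_representative[OF assms] by metis
  have entry: "entry X i j = partials [j] (\<lambda>x. ham_vf H x $ i) 0" for i j
  proof -
    have "partials [j] X 0 = partials [j] (ham_vf H) 0"
      by (rule partials_cong_open[where V = "ball 0 r"]) (use H in auto)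
    moreover have "smooth_on (ball 0 r) (\<lambda>x. ham_vf H x $ i)" for i
    proof -
      have "\<forall>i. smooth_on (ball 0 r) (\<lambda>x. ham_vf H x $ i)"
        unfolding forall_6 ham_vf_nth
        by (intro conjI smooth_on_minus smooth_on_partials H) auto
      then show ?thesis by blast
    qed
    then have "partials [j] (ham_vf H) 0 $ i = partials [j] (\<lambda>x. ham_vf H x $ i) 0"
      using smooth_on_components(2)[where V = "ball 0 r" and f = "ham_vf H"] H(1) by (simp)
    ultimately show ?thesis by (simp add: entry_def)
  qed
  have two: "partials [j] (partials [i] H) 0 = partials [j, i] H 0" for i j by (simp add: partials.simps)
  have neg: "partials [j] (\<lambda>x. - partials [i] H x) 0 = - partials [j, i] H 0" for i j
    using partials_minus[of "ball 0 r" "partials [i] H" 0 "[j]"] smooth_on_partials[OF H(2), of "[i]"] H(1) by (simp add: two)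
  have sym: "partials [j, i] H 0 = partials [i, j] H 0" for i j
    by (rule partials_commute[of "ball 0 r"]) (use H in auto)
  note e = entry ham_vf_nth two neg
  show "entry X 5 1 = - entry X 2 6" "entry X 5 2 = entry X 1 6"
    and "entry X 5 3 = - entry X 4 6" "entry X 5 4 = entry X 3 6"
    and "entry X 6 1 = entry X 2 5" "entry X 6 2 = - entry X 1 5"
    and "entry X 6 3 = entry X 4 5" "entry X 6 4 = - entry X 3 5"
    unfolding e using sym by (simp_all)
qed

lemma linearization_nth:
  assumes "X \<in> Omega2"
  shows "linearization X x $ 1 = entry X 1 5 * x $ 5 + entry X 1 6 * x $ 6"
    and "linearization X x $ 2 = entry X 2 5 * x $ 5 + entry X 2 6 * x $ 6"
    and "linearization X x $ 3 = entry X 3 5 * x $ 5 + entry X 3 6 * x $ 6"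
    and "linearization X x $ 4 = entry X 4 5 * x $ 5 + entry X 4 6 * x $ 6"
    and "linearization X x $ 5 = - entry X 2 6 * x $ 1 + entry X 1 6 * x $ 2 - entry X 4 6 * x $ 3 + entry X 3 6 * x $ 4"
    and "linearization X x $ 6 = entry X 2 5 * x $ 1 - entry X 1 5 * x $ 2 + entry X 4 5 * x $ 3 - entry X 3 5 * x $ 4"
proof -
  have "linearization X x $ i = (\<Sum>j\<in>UNIV. x $ j * entry X i j)" for i
    by (simp add: linearization_def entry_def)
  note lin = this[unfolded sum_UNIV_6]
  note e = entries_Omega2[OF assms]
  show "linearization X x $ 1 = entry X 1 5 * x $ 5 + entry X 1 6 * x $ 6"
    and "linearization X x $ 2 = entry X 2 5 * x $ 5 + entry X 2 6 * x $ 6"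
    and "linearization X x $ 3 = entry X 3 5 * x $ 5 + entry X 3 6 * x $ 6"
    and "linearization X x $ 4 = entry X 4 5 * x $ 5 + entry X 4 6 * x $ 6"
    and "linearization X x $ 5 = - entry X 2 6 * x $ 1 + entry X 1 6 * x $ 2 - entry X 4 6 * x $ 3 + entry X 3 6 * x $ 4"
    and "linearization X x $ 6 = entry X 2 5 * x $ 1 - entry X 1 5 * x $ 2 + entry X 4 5 * x $ 3 - entry X 3 5 * x $ 4"
    unfolding lin by (simp_all add: e)
qed

text \<open>The composition of the two off-diagonal blocks on the antisymmetric plane is a multiple of the
  identity: up to sign the blocks are symplectic adjoints of each other, so the composition
  represents the pullback of the symplectic form of \<open>\<real>\<^sup>4\<close> to the plane, and every
  alternating form on a plane is a multiple of the area form.\<close>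

lemma linearization_cube:
  assumes "X \<in> Omega2"
  shows "linearization X (linearization X (linearization X x)) = discriminant X *\<^sub>R linearization X x"
  by (simp add: vec_eq_iff forall_6 linearization_nth[OF assms] discriminant_def algebra_simps)

lemma linearization_preimage:
  assumes "X \<in> Omega2" "discriminant X \<noteq> 0"
  obtains u where "linearization X u = axis 5 1" "R2 u = u"
proof
  let ?u = "(1 / discriminant X) *\<^sub>R linearization X (axis 5 1)"
  have "linearization X (linearization X (axis 5 1)) = discriminant X *\<^sub>R axis 5 1"
    by (simp add: vec_eq_iff forall_6 linearization_nth[OF assms(1)] discriminant_def axis_def algebra_simps)
  then show "linearization X ?u = axis 5 1"
    using assms(2) by (simp add: linear_scale[OF linear_linearization])
  show "R2 ?u = ?u"
    by (simp add: R2_fixed_iff linearization_nth[OF assms(1)] axis_def)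
qed

text \<open>The kernel of the lower left block, a two-by-four matrix, contains the vectors built from its
  minors. At least one of the two minors in the discriminant is nonzero, and that minor is, up
  to sign, a component of the chosen vector.\<close>

lemma linearization_kernel:
  assumes "X \<in> Omega2" "discriminant X \<noteq> 0"
  obtains z where "linearization X z = 0" "R2 z = z" "z \<noteq> 0"
proof (cases "entry X 1 6 * entry X 2 5 - entry X 1 5 * entry X 2 6 = 0")
  case False
  let ?z = "vector [entry X 1 6 * entry X 4 5 - entry X 4 6 * entry X 1 5,
      entry X 4 5 * entry X 2 6 - entry X 4 6 * entry X 2 5,
      - (entry X 1 6 * entry X 2 5 - entry X 1 5 * entry X 2 6), 0, 0, 0] :: real^6"
  show thesis
  proof
    show "linearization X ?z = 0"
      by (simp add: vec_eq_iff forall_6 linearization_nth[OF assms(1)] vector_6_nth algebra_simps)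
    show "R2 ?z = ?z" by (simp add: R2_fixed_iff vector_6_nth)
    have "?z $ 3 \<noteq> 0" using False by (simp add: vector_6_nth)
    then show "?z \<noteq> 0" by (metis zero_index)
  qed
next
  case True
  then have nz: "entry X 3 6 * entry X 4 5 - entry X 3 5 * entry X 4 6 \<noteq> 0"
    using assms(2) by (simp add: discriminant_def)
  let ?z = "vector [- (entry X 3 6 * entry X 4 5 - entry X 3 5 * entry X 4 6), 0,
      entry X 3 6 * entry X 2 5 - entry X 2 6 * entry X 3 5,
      entry X 2 5 * entry X 4 6 - entry X 2 6 * entry X 4 5, 0, 0] :: real^6"
  show thesis
  proof
    show "linearization X ?z = 0"
      by (simp add: vec_eq_iff forall_6 linearization_nth[OF assms(1)] vector_6_nth algebra_simps)
    show "R2 ?z = ?z" by (simp add: R2_fixed_iff vector_6_nth)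
    have "?z $ 1 \<noteq> 0" using nz by (simp add: vector_6_nth)
    then show "?z \<noteq> 0" by (metis zero_index)
  qed
qed

section \<open>Eigenvalues of the linear part\<close>

text \<open>Triangularity with respect to a numbering of the indices. It is stated with an explicit rank
  because in the type \<open>6\<close> the index \<open>6\<close> equals \<open>0\<close> and so precedes the others in
  the order of the type. Only the identity permutation contributes: a permutation that never increases
  the rank preserves it, since the ranks have the same sum before and after.\<close>

lemma det_rank_triangular:
  fixes A :: "'a::comm_ring_1^'n^'n" and rk :: "'n \<Rightarrow> nat"
  assumes "inj rk" and zero: "\<And>i j. rk i < rk j \<Longrightarrow> A $ i $ j = 0"
  shows "det A = (\<Prod>i\<in>UNIV. A $ i $ i)"
proof -
  have "(\<Prod>i\<in>UNIV. A $ i $ p i) = 0" if p: "p permutes UNIV" "p \<noteq> id" for p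
  proof -
    have "\<exists>i. rk i < rk (p i)"
    proof (rule ccontr)
      assume "\<not> ?thesis"
      then have le: "rk (p i) \<le> rk i" for i by (meson not_le)
      have "(\<Sum>i\<in>UNIV. rk (p i)) = (\<Sum>i\<in>UNIV. rk i)"
        using sum.permute[OF p(1), of rk] by (simp add: o_def)
      then have "rk (p i) = rk i" for i
        by (rule sum_mono_inv) (use le in auto)
      then show False using p(2) \<open>inj rk\<close> by (auto simp: fun_eq_iff dest: injD)
    qed
    then show ?thesis using zero by (meson UNIV_I finite prod_zero)
  qed
  then have "det A = (\<Sum>p\<in>{id}. of_int (sign p) * (\<Prod>i\<in>UNIV. A $ i $ p i))"
    unfolding det_def by (intro sum.mono_neutral_right) (auto simp: permutes_id)
  then show ?thesis by (simp add: sign_id)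
qed

lemma linear_part_eq:
  "linear_part X $ i $ j = complex_of_real (entry X i j)"
  by (simp add: linear_part_def jacobian_def matrix_def entry_def partials.simps)

lemma prod_UNIV_6: "(\<Prod>i\<in>(UNIV :: 6 set). f i) = f 1 * f 2 * f 3 * f 4 * f 5 * f 6"
  unfolding UNIV_6 by (subst prod.insert | simp add: mult.assoc)+

text \<open>Write the characteristic matrix as \<open>M\<close> with blocks \<open>t I\<close>, \<open>- A\<close>, \<open>- B\<close>,
  \<open>t I\<close>. Multiplication by the block triangular matrix \<open>S\<close> with blocks \<open>I\<close>,
  \<open>A\<close>, \<open>0\<close>, \<open>t I\<close> clears the upper right block and leaves
  \<open>t\<^sup>2 I - B A\<close> in the lower right one. This block is a multiple of the identity, so both
  determinants are products of diagonal entries, and \<open>det S = t\<^sup>2\<close> cancels.\<close>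

lemma charpoly_Omega2:
  assumes "X \<in> Omega2"
  shows "charpoly (linear_part X) = [:0, 1:]\<^sup>2 * [:- of_real (discriminant X), 0, 1:]\<^sup>2"
proof -
  define t :: "complex poly" where "t = [:0, 1:]"
  define e where "e i j = [:complex_of_real (entry X i j):]" for i j
  define M :: "complex poly^6^6" where "M = (\<chi> i j. (if i = j then t else 0) - e i j)"
  define S :: "complex poly^6^6" where
    "S = (\<chi> i j. if i \<in> {5, 6} \<and> j = i then t else if i = j then 1
       else if i \<in> {1, 2, 3, 4} \<and> j \<in> {5, 6} then e i j else 0)"
  define rk :: "6 \<Rightarrow> nat" where
    "rk i = (if i = 1 then 1 else if i = 2 then 2 else if i = 3 then 3
       else if i = 4 then 4 else if i = 5 then 5 else 6)" for i
  have inj: "inj rk" "inj (\<lambda>i. 6 - rk i)"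
    unfolding inj_def forall_6 by (simp_all add: rk_def)
  have e0: "e i j = 0" if "entry X i j = 0" for i j
    using that by (simp add: e_def)
  note E = entries_Omega2[OF assms]
  have e_sym: "e 5 1 = - e 2 6" "e 5 2 = e 1 6" "e 5 3 = - e 4 6" "e 5 4 = e 3 6"
    "e 6 1 = e 2 5" "e 6 2 = - e 1 5" "e 6 3 = e 4 5" "e 6 4 = - e 3 5"
    unfolding e_def by (simp_all add: E)
  define D where "D = [:complex_of_real (discriminant X):]"
  have D: "D = e 1 6 * e 2 5 - e 1 5 * e 2 6 + e 3 6 * e 4 5 - e 3 5 * e 4 6"
    by (simp add: D_def e_def discriminant_def)
  have det_S: "det S = t\<^sup>2"
  proof -
    have "\<forall>i j. 6 - rk i < 6 - rk j \<longrightarrow> S $ i $ j = 0"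
      unfolding forall_6 by (simp add: rk_def S_def)
    then have "det S = (\<Prod>i\<in>UNIV. S $ i $ i)"
      by (intro det_rank_triangular[OF inj(2)]) auto
    then show ?thesis by (simp add: prod_UNIV_6 S_def power2_eq_square)
  qed
  have MS: "(M ** S) $ i $ j = (\<Sum>k\<in>UNIV. M $ i $ k * S $ k $ j)" for i j
    by (simp add: matrix_matrix_mult_def)
  have "\<forall>i j. rk i < rk j \<longrightarrow> (M ** S) $ i $ j = 0"
    unfolding forall_6 MS sum_UNIV_6
    by (simp add: rk_def S_def M_def e0 E e_sym algebra_simps)
  then have "det (M ** S) = (\<Prod>i\<in>UNIV. (M ** S) $ i $ i)"
    by (intro det_rank_triangular[OF inj(1)]) auto
  also have "\<dots> = t ^ 4 * (t\<^sup>2 - D)\<^sup>2"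
    unfolding prod_UNIV_6 MS sum_UNIV_6
    by (simp add: S_def M_def e0 E e_sym D algebra_simps power2_eq_square power4_eq_xxxx)
  finally have "t\<^sup>2 * det M = t\<^sup>2 * (t\<^sup>2 * (t\<^sup>2 - D)\<^sup>2)"
    using det_S by (simp add: det_mul algebra_simps power2_eq_square power4_eq_xxxx)
  moreover have "t\<^sup>2 \<noteq> 0" by (simp add: t_def)
  ultimately have "det M = t\<^sup>2 * (t\<^sup>2 - D)\<^sup>2" by (metis mult_left_cancel)
  moreover have "charpoly (linear_part X) = det M"
    unfolding charpoly_def M_def t_def e_def linear_part_eq ..
  moreover have "t\<^sup>2 - D = [:- of_real (discriminant X), 0, 1:]"
    by (simp add: t_def D_def power2_eq_square)
  ultimately show ?thesis by (simp add: t_def)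
qed

lemma nonzero_eigenvalues_Omega2:
  assumes "X \<in> Omega2" "0 < \<alpha>" "discriminant X = - \<alpha>\<^sup>2"
  shows "nonzero_eigenvalues_pm_i_double (linear_part X) \<alpha>"
proof -
  let ?a = "\<i> * complex_of_real \<alpha>"
  have "[:- of_real (discriminant X), 0, 1:] = [:- ?a, 1:] * [:?a, 1:]"
    by (simp add: assms(3) power_mult_distrib flip: power2_eq_square)
  then have c: "charpoly (linear_part X) = [:- ?a, 1:] ^ 2 * ([:0, 1:]\<^sup>2 * [:?a, 1:]\<^sup>2)"
    "charpoly (linear_part X) = [:- (- ?a), 1:] ^ 2 * ([:0, 1:]\<^sup>2 * [:- ?a, 1:]\<^sup>2)"
    unfolding charpoly_Omega2[OF assms(1)] by (simp_all only: power_mult_distrib minus_minus mult_ac)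
  have "?a \<noteq> 0" using assms(2) by simp
  have ord: "order b ([:- b, 1:] ^ 2 * ([:0, 1:]\<^sup>2 * [:b, 1:]\<^sup>2)) = 2" if "b \<noteq> 0" for b :: complex
  proof -
    have "[:- b, 1:] ^ 2 * ([:0, 1:]\<^sup>2 * [:b, 1:]\<^sup>2) \<noteq> 0" by simp
    moreover have "order b ([:0, 1:]\<^sup>2 * [:b, 1:]\<^sup>2) = 0"
      using that by (intro order_0I) simp
    ultimately show ?thesis by (simp add: order_mult order_power_n_n)
  qed
  have "{\<mu>. poly (charpoly (linear_part X)) \<mu> = 0 \<and> \<mu> \<noteq> 0} = {?a, - ?a}"
    using \<open>?a \<noteq> 0\<close> unfolding c(1) by (auto simp: add_eq_0_iff)
  moreover have "order ?a (charpoly (linear_part X)) = 2"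
    using ord[of ?a] \<open>?a \<noteq> 0\<close> unfolding c(1) by blast
  moreover have "order (- ?a) (charpoly (linear_part X)) = 2"
    using ord[of "- ?a"] \<open>?a \<noteq> 0\<close> unfolding c(2) by simp
  ultimately show ?thesis by (simp add: nonzero_eigenvalues_pm_i_double_def)
qed

section \<open>Symmetric periodic orbits near an elliptic equilibrium\<close>

text \<open>The first half wave of a function close to a sine: it increases up to phase \<open>\<pi>/3\<close>, stays
  positive up to \<open>2\<pi>/3\<close>, and decreases from there to a negative value at \<open>4\<pi>/3\<close>.\<close>

lemma near_sine_first_zero:
  fixes y :: "real \<Rightarrow> real"
  assumes "0 < \<alpha>" "0 < s" "y 0 = 0"
    and der: "\<And>t. 0 \<le> t \<Longrightarrow> \<alpha> * t \<le> 4 * pi / 3 \<Longrightarrow> (y has_real_derivative y' t) (at t)"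
    and near: "\<And>t. 0 \<le> t \<Longrightarrow> \<alpha> * t \<le> 4 * pi / 3 \<Longrightarrow> \<bar>y t - s * (sin (\<alpha> * t) / \<alpha>)\<bar> \<le> s / (4 * \<alpha>)"
    and near': "\<And>t. 0 \<le> t \<Longrightarrow> \<alpha> * t \<le> 4 * pi / 3 \<Longrightarrow> \<bar>y' t - s * cos (\<alpha> * t)\<bar> \<le> s / 4"
  obtains T where "2 * pi / 3 < \<alpha> * T" "\<alpha> * T < 4 * pi / 3" "y T = 0"
    "\<And>t. 0 < t \<Longrightarrow> t < T \<Longrightarrow> 0 < y t"
    "\<And>t. T < t \<Longrightarrow> \<alpha> * t \<le> 4 * pi / 3 \<Longrightarrow> y t < 0"
proof -
  define a b c where "a = pi / (3 * \<alpha>)" and "b = 2 * pi / (3 * \<alpha>)" and "c = 4 * pi / (3 * \<alpha>)"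
  have abc: "\<alpha> * a = pi / 3" "\<alpha> * b = 2 * pi / 3" "\<alpha> * c = 4 * pi / 3" "0 < a" "a < b" "b < c"
    using \<open>0 < \<alpha>\<close> by (auto simp: a_def b_def c_def field_simps)
  have le: "t \<le> a \<longleftrightarrow> \<alpha> * t \<le> pi / 3" "t \<le> b \<longleftrightarrow> \<alpha> * t \<le> 2 * pi / 3" "t \<le> c \<longleftrightarrow> \<alpha> * t \<le> 4 * pi / 3"
    "a \<le> t \<longleftrightarrow> pi / 3 \<le> \<alpha> * t" "b \<le> t \<longleftrightarrow> 2 * pi / 3 \<le> \<alpha> * t" for t
    using \<open>0 < \<alpha>\<close> by (auto simp: a_def b_def c_def field_simps)
  have cos_ge: "1 / 2 \<le> cos x" if "\<bar>x\<bar> \<le> pi / 3" for x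
    using cos_monotone_0_pi_le[of "\<bar>x\<bar>" "pi / 3"] that pi_gt_zero by (simp add: cos_60)
  have close_pos: "0 < v" if "2 * A \<le> S" "\<bar>v - S\<bar> \<le> A" "0 < A" for v S A :: real
    using that by linarith
  have close_neg: "v < 0" if "S \<le> - (2 * A)" "\<bar>v - S\<bar> \<le> A" "0 < A" for v S A :: real
    using that by linarith
  have up: "0 < y' t" if "0 \<le> t" "t \<le> a" for t
  proof -
    have "\<alpha> * t \<le> pi / 3" "0 \<le> \<alpha> * t" using that \<open>0 < \<alpha>\<close> by (auto simp: le)
    then have "s * (1 / 2) \<le> s * cos (\<alpha> * t)"
      using \<open>0 < s\<close> by (intro mult_left_mono cos_ge) auto
    moreover have "\<alpha> * t \<le> 4 * pi / 3" using \<open>\<alpha> * t \<le> pi / 3\<close> pi_gt_zero by linarith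
    ultimately show ?thesis using near'[OF that(1)] \<open>0 < s\<close> by linarith
  qed
  have middle: "0 < y t" if "a \<le> t" "t \<le> b" for t
  proof -
    have *: "pi / 3 \<le> \<alpha> * t" "\<alpha> * t \<le> 2 * pi / 3" using that by (auto simp: le)
    then have "\<bar>\<alpha> * t - pi / 2\<bar> \<le> pi / 3" by (intro abs_leI) linarith+
    then have "1 / 2 \<le> cos (\<alpha> * t - pi / 2)" by (rule cos_ge)
    then have "1 / 2 \<le> sin (\<alpha> * t)" by (simp add: cos_diff)
    then have "s * (1 / 2 / \<alpha>) \<le> s * (sin (\<alpha> * t) / \<alpha>)"
      using \<open>0 < s\<close> \<open>0 < \<alpha>\<close> by (intro mult_left_mono divide_right_mono) auto
    moreover have "s * (1 / 2 / \<alpha>) = 2 * (s / (4 * \<alpha>))" by simp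
    ultimately have "2 * (s / (4 * \<alpha>)) \<le> s * (sin (\<alpha> * t) / \<alpha>)" by simp
    moreover have "\<bar>y t - s * (sin (\<alpha> * t) / \<alpha>)\<bar> \<le> s / (4 * \<alpha>)"
      using that abc * pi_gt_zero by (intro near) linarith+
    moreover have "0 < s / (4 * \<alpha>)" using \<open>0 < s\<close> \<open>0 < \<alpha>\<close> by simp
    ultimately show ?thesis by (rule close_pos)
  qed
  have down: "y' t < 0" if "b \<le> t" "t \<le> c" for t
  proof -
    have *: "2 * pi / 3 \<le> \<alpha> * t" "\<alpha> * t \<le> 4 * pi / 3" using that by (auto simp: le)
    then have "\<bar>\<alpha> * t - pi\<bar> \<le> pi / 3" by (intro abs_leI) linarith+
    then have "1 / 2 \<le> cos (\<alpha> * t - pi)" by (rule cos_ge)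
    then have "cos (\<alpha> * t) \<le> - (1 / 2)" by (simp add: cos_diff)
    then have "s * cos (\<alpha> * t) \<le> s * - (1 / 2)" using \<open>0 < s\<close> by (intro mult_left_mono) auto
    moreover have "\<bar>y' t - s * cos (\<alpha> * t)\<bar> \<le> s / 4"
      using that abc * by (intro near') linarith+
    ultimately show ?thesis using \<open>0 < s\<close> by linarith
  qed
  have final: "y c < 0"
  proof -
    have "\<alpha> * c = pi / 3 + pi" using abc(3) by simp
    then have "sin (\<alpha> * c) = - sin (pi / 3)" by (simp only: sin_periodic_pi)
    also have "\<dots> \<le> - (1 / 2)" using real_sqrt_ge_1_iff[of 3] by (simp add: sin_60)
    finally have "s * (sin (\<alpha> * c) / \<alpha>) \<le> s * (- (1 / 2) / \<alpha>)"
      using \<open>0 < s\<close> \<open>0 < \<alpha>\<close> by (intro mult_left_mono divide_right_mono) auto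
    moreover have "s * (- (1 / 2) / \<alpha>) = - (2 * (s / (4 * \<alpha>)))" by simp
    ultimately have "s * (sin (\<alpha> * c) / \<alpha>) \<le> - (2 * (s / (4 * \<alpha>)))" by simp
    moreover have "\<bar>y c - s * (sin (\<alpha> * c) / \<alpha>)\<bar> \<le> s / (4 * \<alpha>)"
      using abc by (intro near) linarith+
    moreover have "0 < s / (4 * \<alpha>)" using \<open>0 < s\<close> \<open>0 < \<alpha>\<close> by simp
    ultimately show ?thesis by (rule close_neg)
  qed
  have cont: "continuous_on {b..c} y"
  proof (rule continuous_at_imp_continuous_on, rule ballI)
    fix t assume "t \<in> {b..c}"
    then have "0 \<le> t" "t \<le> c" using abc by auto
    then show "isCont y t" using der[of t] le(3) DERIV_isCont by blast
  qed
  obtain T where T: "b \<le> T" "T \<le> c" "y T = 0"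
    using IVT2'[of y c 0 b] final middle[of b] abc cont by auto
  have less: "y v < y u" if "b \<le> u" "u < v" "v \<le> c" for u v
  proof (rule DERIV_neg_imp_decreasing[OF that(2)])
    fix t assume "u \<le> t" "t \<le> v"
    then have "b \<le> t" "t \<le> c" "0 \<le> t" using that abc by linarith+
    then show "\<exists>d. (y has_real_derivative d) (at t) \<and> d < 0"
      using der[of t] down[of t] le(3) by blast
  qed
  show thesis
  proof
    show "y T = 0" by fact
    have "T \<noteq> b" using middle[of b] abc T by auto
    then show "2 * pi / 3 < \<alpha> * T" using T abc \<open>0 < \<alpha>\<close> by (metis le(2) not_le order_antisym)
    have "T \<noteq> c" using final T by auto
    then show "\<alpha> * T < 4 * pi / 3" using T abc \<open>0 < \<alpha>\<close>
      by (metis less_le mult_less_cancel_left_pos)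
    show "y t < 0" if "T < t" "\<alpha> * t \<le> 4 * pi / 3" for t
      using less[of T t] T that by (simp add: le)
    show "0 < y t" if "0 < t" "t < T" for t
    proof -
      consider "t \<le> a" | "a \<le> t" "t \<le> b" | "b \<le> t" by linarith
      then show ?thesis
      proof cases
        case 1
        have "y 0 < y t"
        proof (rule DERIV_pos_imp_increasing[OF that(1)])
          fix u assume "0 \<le> u" "u \<le> t"
          then have "u \<le> a" "u \<le> c" using 1 abc by linarith+
          then show "\<exists>d. (y has_real_derivative d) (at u) \<and> 0 < d"
            using der[of u] up[of u] le(3) \<open>0 \<le> u\<close> by blast
        qed
        then show ?thesis using assms(3) by simp
      next
        case 2 then show ?thesis by (rule middle)
      next
        case 3 then show ?thesis using less[of t T] T that by simp
      qed
    qed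
  qed
qed

definition has_two_periodic_families :: "(real^6 \<Rightarrow> real^6) \<Rightarrow> real \<Rightarrow> bool" where
  "has_two_periodic_families X \<alpha> \<longleftrightarrow> (\<exists>\<epsilon>>0. \<exists>\<gamma>1 \<gamma>2 T1 T2.
          periodic_family X \<epsilon> \<gamma>1 T1 \<and> periodic_family X \<epsilon> \<gamma>2 T2 \<and>
          (\<forall>\<sigma>\<in>{-\<epsilon><..<\<epsilon>} - {0}. \<forall>\<sigma>'\<in>{-\<epsilon><..<\<epsilon>} - {0}.
             \<forall>l\<in>{0..2*pi}. \<forall>l'\<in>{0..2*pi}. range (\<gamma>1 \<sigma> l) \<noteq> range (\<gamma>2 \<sigma>' l')) \<and>
          (\<forall>(\<gamma>, T)\<in>{(\<gamma>1, T1), (\<gamma>2, T2)}. \<forall>l\<in>{0..2*pi}.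
             (\<forall>r>0. \<forall>\<^sub>F \<sigma> in at 0. range (\<gamma> \<sigma> l) \<subseteq> ball 0 r) \<and>
             ((\<lambda>\<sigma>. T \<sigma> l) \<longlongrightarrow> 2 * pi / \<alpha>) (at 0)))"

text \<open>A global reversible Lipschitz field with an elliptic equilibrium at the origin that is
  Hamiltonian near the origin. The vector \<open>u\<close> is the symmetric vector whose linear velocity is
  the unit vector of the fifth axis; \<open>z\<close> spans a line of equilibria of the linear part and
  serves to move the starting points.\<close>

locale reversible_center = lipschitz_flow F K \<psi>
  for F :: "real^6 \<Rightarrow> real^6" and K \<psi> +
  fixes L :: "real^6 \<Rightarrow> real^6" and \<alpha> :: real and H :: "real^6 \<Rightarrow> real" and r :: real
    and u z :: "real^6"
  assumes reversible: "F (R2 x) = - R2 (F x)"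
    and linear_L: "linear L"
    and L_R2: "L (R2 x) = - R2 (L x)"
    and L_cube: "L (L (L x)) = - (\<alpha>\<^sup>2) *\<^sub>R L x"
    and \<alpha>_pos: "0 < \<alpha>"
    and r_pos: "0 < r"
    and small: "0 < \<epsilon> \<Longrightarrow> \<exists>\<rho>>0. \<forall>x. norm x \<le> \<rho> \<longrightarrow> norm (F x - L x) \<le> \<epsilon> * norm x"
    and smooth_H: "smooth_on (ball 0 r) H"
    and hamiltonian: "x \<in> ball 0 r \<Longrightarrow> F x = ham_vf H x"
    and u: "L u = axis 5 1" "R2 u = u"
    and z: "L z = 0" "R2 z = z" "z \<noteq> 0"
begin

lemma L_bound: obtains B where "0 < B" "\<And>x. norm (L x) \<le> B * norm x"
proof -
  have "bounded_linear L" using linear_L linear_conv_bounded_linear by blast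
  then show thesis using bounded_linear.pos_bounded that by (metis mult.commute)
qed

text \<open>Orbits will start at the points \<open>s *\<^sub>R direction \<kappa>\<close>. They lie in the fixed space
  of the involution, and along them the linear velocity is \<open>s\<close> times the fifth unit vector,
  for every \<open>\<kappa>\<close>.\<close>

definition direction :: "real \<Rightarrow> real^6" where "direction \<kappa> = u + \<kappa> *\<^sub>R z"

lemma R2_direction [simp]: "R2 (c *\<^sub>R direction \<kappa>) = c *\<^sub>R direction \<kappa>"
  by (simp add: direction_def linear_scale[OF linear_R2] linear_add[OF linear_R2] u z)

lemma L_direction: "L (direction \<kappa>) = axis 5 1"
  by (simp add: direction_def linear_scale[OF linear_L] linear_add[OF linear_L] u z)

lemma LL_axis_5: "L (L (axis 5 1)) = - (\<alpha>\<^sup>2) *\<^sub>R axis 5 1"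
  using L_cube[of u] u by simp

lemma axis_5_5: "axis 5 (1::real) $ (5::6) = 1"
  by (simp add: axis_def)

lemma L_antisymmetric_5:
  assumes "x $ 1 = 0" "x $ 2 = 0" "x $ 3 = 0" "x $ 4 = 0"
  shows "L x $ 5 = 0"
proof -
  have "R2 x = - x"
    using assms by (simp add: vec_eq_iff forall_6)
  then have "- L x = - R2 (L x)"
    using L_R2[of x] linear_neg[OF linear_L] by metis
  then have "L x $ 5 = R2 (L x) $ 5" by simp
  then show ?thesis by simp
qed

lemma L_axis_5: "L (axis 5 1) $ 5 = 0"
  by (rule L_antisymmetric_5) (simp_all add: axis_def)

text \<open>The exponential of \<open>t L\<close> applied to \<open>direction \<kappa>\<close>, in the closed form that
  \<open>L\<^sup>3 = - \<alpha>\<^sup>2 L\<close> gives.\<close>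

definition lin_orbit :: "real \<Rightarrow> real \<Rightarrow> real^6" where
  "lin_orbit \<kappa> t = direction \<kappa> + (sin (\<alpha> * t) / \<alpha>) *\<^sub>R axis 5 1
     + ((1 - cos (\<alpha> * t)) / \<alpha>\<^sup>2) *\<^sub>R L (axis 5 1)"

lemma L_lin_orbit: "L (lin_orbit \<kappa> t) = cos (\<alpha> * t) *\<^sub>R axis 5 1 + (sin (\<alpha> * t) / \<alpha>) *\<^sub>R L (axis 5 1)"
  using \<alpha>_pos
  by (simp add: lin_orbit_def linear_scale[OF linear_L] linear_add[OF linear_L] L_direction LL_axis_5 scaleR_diff_left)

lemma lin_orbit_deriv: "(lin_orbit \<kappa> has_vector_derivative L (lin_orbit \<kappa> t)) (at t)"
  unfolding L_lin_orbit unfolding lin_orbit_def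
  using \<alpha>_pos
  by (auto intro!: derivative_eq_intros simp: has_vector_derivative_def algebra_simps power2_eq_square fun_eq_iff)

lemma lin_orbit_0: "lin_orbit \<kappa> 0 = direction \<kappa>"
  by (simp add: lin_orbit_def)

lemma lin_orbit_5: "lin_orbit \<kappa> t $ 5 = sin (\<alpha> * t) / \<alpha>"
proof -
  have "direction \<kappa> $ 5 = 0" using R2_direction[of 1 \<kappa>] by (simp add: R2_fixed_iff)
  then show ?thesis by (simp add: lin_orbit_def L_axis_5 axis_5_5)
qed

lemma L_lin_orbit_5: "L (lin_orbit \<kappa> t) $ 5 = cos (\<alpha> * t)"
  by (simp add: L_lin_orbit L_axis_5 axis_5_5)

text \<open>The two families use \<open>\<kappa>\<close> in \<open>[0, 2\<pi>]\<close> and in \<open>[- 1 - 2\<pi>, - 1]\<close>.\<close>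

definition slope_max :: real where "slope_max = 2 * pi + 1"

lemma norm_direction: "\<bar>\<kappa>\<bar> \<le> slope_max \<Longrightarrow> norm (direction \<kappa>) \<le> norm u + slope_max * norm z"
  unfolding direction_def using norm_triangle_ineq[of u "\<kappa> *\<^sub>R z"] mult_right_mono[of "\<bar>\<kappa>\<bar>" slope_max "norm z"] by simp

definition orb :: "real \<Rightarrow> real \<Rightarrow> real \<Rightarrow> real^6" where "orb s \<kappa> = \<psi> (s *\<^sub>R direction \<kappa>)"

text \<open>The factor by which the norm can grow within time \<open>3\<pi>/\<alpha>\<close>, which exceeds one full period of
  all orbits considered.\<close>

definition growth :: real where "growth = exp ((K + 1 / 2) * (3 * pi / \<alpha>))"

lemma orb_bound:
  assumes "\<bar>\<kappa>\<bar> \<le> slope_max" "0 \<le> s" "0 \<le> t" "t \<le> 3 * pi / \<alpha>"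
  shows "norm (orb s \<kappa> t) \<le> s * ((norm u + slope_max * norm z) * growth)"
proof -
  have "norm (orb s \<kappa> t) \<le> norm (s *\<^sub>R direction \<kappa>) * exp ((K + 1 / 2) * \<bar>t\<bar>)"
    unfolding orb_def by (rule norm_flow_le)
  also have "\<dots> \<le> (s * (norm u + slope_max * norm z)) * growth"
  proof (intro mult_mono)
    show "norm (s *\<^sub>R direction \<kappa>) \<le> s * (norm u + slope_max * norm z)"
      using assms(2) norm_direction[OF assms(1)] by (simp add: mult_left_mono)
    have "(K + 1 / 2) * \<bar>t\<bar> \<le> (K + 1 / 2) * (3 * pi / \<alpha>)"
      using assms(3,4) K_pos by (intro mult_left_mono) auto
    then show "exp ((K + 1 / 2) * \<bar>t\<bar>) \<le> growth" by (simp add: growth_def)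
  qed (use assms(2) pi_gt_zero in \<open>auto simp: slope_max_def\<close>)
  finally show ?thesis by (simp add: mult.assoc)
qed

text \<open>On the scale \<open>s\<close> the nonlinear part is negligible, uniformly on the time window and in
  \<open>\<kappa>\<close>. The bound on \<open>F - L\<close> covers all points that are not further from the
  origin than the orbit, since the energy argument leaves the orbit.\<close>

lemma orb_near_linear:
  assumes "0 < \<eta>"
  obtains s1 where "0 < s1" "\<And>s \<kappa> t. 0 < s \<Longrightarrow> s < s1 \<Longrightarrow> \<bar>\<kappa>\<bar> \<le> slope_max \<Longrightarrow> 0 \<le> t \<Longrightarrow> t \<le> 3 * pi / \<alpha> \<Longrightarrow>
    norm (orb s \<kappa> t - s *\<^sub>R lin_orbit \<kappa> t) \<le> \<eta> * s \<and> norm (orb s \<kappa> t) < r \<and>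
    (\<forall>x. norm x \<le> norm (orb s \<kappa> t) \<longrightarrow> norm (F x - L x) \<le> \<eta> * s)"
proof -
  obtain B where B: "0 < B" "\<And>x. norm (L x) \<le> B * norm x" using L_bound by blast
  define b where "b = 3 * pi / \<alpha>"
  have "0 < b" using \<alpha>_pos by (simp add: b_def)
  define C where "C = (norm u + slope_max * norm z) * growth"
  have "0 \<le> C" using pi_gt_zero by (simp add: C_def growth_def slope_max_def)
  define D where "D = sqrt (b * exp ((2 * B + 1) * b)) + 1"
  have D1: "1 \<le> D" using \<open>0 < b\<close> by (simp add: D_def)
  define \<eta>' where "\<eta>' = \<eta> / ((C + 1) * D)"
  have "0 < \<eta>'" using assms \<open>0 \<le> C\<close> D1 by (simp add: \<eta>'_def)
  from small[OF this] obtain \<rho> where \<rho>: "0 < \<rho>" "\<And>x. norm x \<le> \<rho> \<Longrightarrow> norm (F x - L x) \<le> \<eta>' * norm x" by blast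
  define s1 where "s1 = min \<rho> r / (C + 1)"
  have orb_small: "norm (orb s \<kappa> t) \<le> C * s \<and> norm (orb s \<kappa> t) \<le> \<rho> \<and> norm (orb s \<kappa> t) < r"
    if "0 < s" "s < s1" "\<bar>\<kappa>\<bar> \<le> slope_max" "0 \<le> t" "t \<le> b" for s \<kappa> t
  proof -
    have 1: "norm (orb s \<kappa> t) \<le> C * s"
      using orb_bound[of \<kappa> s t] that by (simp add: C_def b_def mult_ac)
    have "s * (C + 1) < min \<rho> r"
      using that(2) \<open>0 \<le> C\<close> by (simp add: s1_def field_simps del: min_less_iff_conj)
    then show ?thesis using 1 that(1) by (simp add: algebra_simps)
  qed
  have F_near: "norm (F x - L x) \<le> \<eta>' * (C * s)"
    if "0 < s" "s < s1" "\<bar>\<kappa>\<bar> \<le> slope_max" "0 \<le> t" "t \<le> b" "norm x \<le> norm (orb s \<kappa> t)" for s \<kappa> t x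
    using orb_small[OF that(1-5)] \<rho>(2)[of x] that(6) mult_left_mono[of "norm x" "C * s" \<eta>'] \<open>0 < \<eta>'\<close> by linarith
  have small_\<eta>: "\<eta>' * (C * s) * D \<le> \<eta> * s" if "0 < s" for s
  proof -
    have "\<eta>' * (C * s) * D = \<eta> * s * (C / (C + 1))"
    proof -
      have "\<eta>' * D = \<eta> / (C + 1)" using D1 by (simp add: \<eta>'_def)
      then show ?thesis by (metis (no_types, lifting) mult.assoc mult.commute times_divide_eq_right)
    qed
    also have "\<dots> \<le> \<eta> * s * 1"
      using assms that \<open>0 \<le> C\<close> by (intro mult_left_mono) auto
    finally show ?thesis by simp
  qed
  show thesis
  proof
    show "0 < s1" using \<rho>(1) r_pos \<open>0 \<le> C\<close> by (simp add: s1_def)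
    fix s \<kappa> t assume s: "0 < s" "s < s1" "\<bar>\<kappa>\<bar> \<le> slope_max" and t: "0 \<le> t" "t \<le> 3 * pi / \<alpha>"
    let ?c = "\<eta>' * (C * s)"
    have c: "0 \<le> ?c" using \<open>0 < \<eta>'\<close> \<open>0 \<le> C\<close> s by simp
    have tb: "t \<le> b" using t by (simp add: b_def)
    have d0: "orb s \<kappa> 0 - s *\<^sub>R lin_orbit \<kappa> 0 = 0"
      by (simp add: orb_def start lin_orbit_0)
    have "(norm (orb s \<kappa> t - s *\<^sub>R lin_orbit \<kappa> t))\<^sup>2
        \<le> ((norm (orb s \<kappa> 0 - s *\<^sub>R lin_orbit \<kappa> 0))\<^sup>2 + ?c\<^sup>2 * t) * exp ((2 * B + 1) * t)"
    proof (rule gronwall_forward[of t B ?c "\<lambda>t. orb s \<kappa> t - s *\<^sub>R lin_orbit \<kappa> t"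
          "\<lambda>t. F (orb s \<kappa> t) - s *\<^sub>R L (lin_orbit \<kappa> t)"])
      fix v assume v: "0 \<le> v" "v \<le> t"
      show "((\<lambda>t. orb s \<kappa> t - s *\<^sub>R lin_orbit \<kappa> t) has_vector_derivative F (orb s \<kappa> v) - s *\<^sub>R L (lin_orbit \<kappa> v)) (at v)"
        unfolding orb_def
        by (intro has_vector_derivative_diff flow bounded_linear.has_vector_derivative[OF bounded_linear_scaleR_right lin_orbit_deriv])
      have "F (orb s \<kappa> v) - s *\<^sub>R L (lin_orbit \<kappa> v)
          = L (orb s \<kappa> v - s *\<^sub>R lin_orbit \<kappa> v) + (F (orb s \<kappa> v) - L (orb s \<kappa> v))"
        by (simp add: linear_diff[OF linear_L] linear_scale[OF linear_L])
      moreover have "norm (F (orb s \<kappa> v) - L (orb s \<kappa> v)) \<le> ?c"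
        by (rule F_near[OF s, of v]) (use v tb in auto)
      ultimately show "norm (F (orb s \<kappa> v) - s *\<^sub>R L (lin_orbit \<kappa> v))
          \<le> B * norm (orb s \<kappa> v - s *\<^sub>R lin_orbit \<kappa> v) + ?c"
        using B(2)[of "orb s \<kappa> v - s *\<^sub>R lin_orbit \<kappa> v"] norm_triangle_le[OF add_mono] by metis
    qed (use t B c in auto)
    also have "\<dots> = ?c\<^sup>2 * (t * exp ((2 * B + 1) * t))"
      unfolding d0 by simp
    also have "\<dots> \<le> ?c\<^sup>2 * (b * exp ((2 * B + 1) * b))"
      using t tb B by (intro mult_left_mono mult_mono) auto
    also have "\<dots> \<le> ?c\<^sup>2 * D\<^sup>2"
    proof (intro mult_left_mono)
      have "b * exp ((2 * B + 1) * b) = (sqrt (b * exp ((2 * B + 1) * b)))\<^sup>2"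
        using \<open>0 < b\<close> by simp
      also have "\<dots> \<le> D\<^sup>2" using \<open>0 < b\<close> unfolding D_def by (intro power_mono) auto
      finally show "b * exp ((2 * B + 1) * b) \<le> D\<^sup>2" .
    qed simp
    finally have "(norm (orb s \<kappa> t - s *\<^sub>R lin_orbit \<kappa> t))\<^sup>2 \<le> (?c * D)\<^sup>2"
      by (simp add: power_mult_distrib)
    then have 1: "norm (orb s \<kappa> t - s *\<^sub>R lin_orbit \<kappa> t) \<le> ?c * D"
      by (rule power2_le_imp_le) (use c D1 in simp)
    have "?c \<le> ?c * D" using c D1 mult_left_mono[of 1 D ?c] by simp
    then show "norm (orb s \<kappa> t - s *\<^sub>R lin_orbit \<kappa> t) \<le> \<eta> * s \<and> norm (orb s \<kappa> t) < r \<and>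
      (\<forall>x. norm x \<le> norm (orb s \<kappa> t) \<longrightarrow> norm (F x - L x) \<le> \<eta> * s)"
      using 1 small_\<eta>[OF s(1)] orb_small[OF s t(1) tb] F_near[OF s t(1) tb] by (meson order.trans)
  qed
qed

text \<open>The fifth component behaves like \<open>s sin (\<alpha> t)/\<alpha>\<close> and its velocity like
  \<open>s cos (\<alpha> t)\<close>. The velocity estimate extends to points that are not
  further from the origin and have the same value of \<open>(L x)\<^sub>5\<close>, in particular to those
  obtained by shrinking the last two coordinates.\<close>

lemma orb_near_oscillation:
  assumes "0 < \<eta>"
  obtains s1 where "0 < s1" "\<And>s \<kappa> t. 0 < s \<Longrightarrow> s < s1 \<Longrightarrow> \<bar>\<kappa>\<bar> \<le> slope_max \<Longrightarrow> 0 \<le> t \<Longrightarrow> t \<le> 3 * pi / \<alpha> \<Longrightarrow>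
    \<bar>orb s \<kappa> t $ 5 - s * (sin (\<alpha> * t) / \<alpha>)\<bar> \<le> \<eta> * s \<and>
    \<bar>L (orb s \<kappa> t) $ 5 - s * cos (\<alpha> * t)\<bar> \<le> \<eta> * s \<and> norm (orb s \<kappa> t) < r \<and>
    (\<forall>x. norm x \<le> norm (orb s \<kappa> t) \<and> L x $ 5 = L (orb s \<kappa> t) $ 5 \<longrightarrow> \<bar>F x $ 5 - s * cos (\<alpha> * t)\<bar> \<le> \<eta> * s)"
proof -
  obtain B where B: "0 < B" "\<And>x. norm (L x) \<le> B * norm x" using L_bound by blast
  define \<eta>' where "\<eta>' = \<eta> / (2 * (B + 1))"
  have \<eta>': "0 < \<eta>'" "B * \<eta>' + \<eta>' \<le> \<eta>" "B * \<eta>' \<le> \<eta>" "\<eta>' \<le> \<eta>"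
  proof -
    have "2 * (B + 1) \<noteq> 0" using B(1) by simp
    then have "\<eta>' * (2 * (B + 1)) = \<eta>"
      unfolding \<eta>'_def by (rule nonzero_divide_eq_eq[THEN iffD1, OF _ refl, symmetric])
    moreover have "0 < \<eta>'" using assms B(1) by (simp add: \<eta>'_def)
    moreover have "0 < B * \<eta>'" using B(1) \<open>0 < \<eta>'\<close> by simp
    ultimately show "0 < \<eta>'" "B * \<eta>' + \<eta>' \<le> \<eta>" "B * \<eta>' \<le> \<eta>" "\<eta>' \<le> \<eta>"
      using assms by (simp_all add: algebra_simps)
  qed
  obtain s1 where s1: "0 < s1" "\<And>s \<kappa> t. 0 < s \<Longrightarrow> s < s1 \<Longrightarrow> \<bar>\<kappa>\<bar> \<le> slope_max \<Longrightarrow> 0 \<le> t \<Longrightarrow> t \<le> 3 * pi / \<alpha> \<Longrightarrow>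
    norm (orb s \<kappa> t - s *\<^sub>R lin_orbit \<kappa> t) \<le> \<eta>' * s \<and> norm (orb s \<kappa> t) < r \<and>
    (\<forall>x. norm x \<le> norm (orb s \<kappa> t) \<longrightarrow> norm (F x - L x) \<le> \<eta>' * s)"
    using orb_near_linear[OF \<eta>'(1)] by metis
  show thesis
  proof (rule that[OF s1(1)])
    fix s \<kappa> t assume a: "0 < s" "s < s1" "\<bar>\<kappa>\<bar> \<le> slope_max" "0 \<le> t" "t \<le> 3 * pi / \<alpha>"
    note n = s1(2)[OF a]
    have scale: "x \<le> c * s \<Longrightarrow> c \<le> \<eta> \<Longrightarrow> x \<le> \<eta> * s" for x c
      using a(1) by (meson mult_right_mono less_imp_le order.trans)
    have "\<bar>(orb s \<kappa> t - s *\<^sub>R lin_orbit \<kappa> t) $ 5\<bar> \<le> \<eta>' * s"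
      using n component_le_norm_cart order.trans by blast
    then have 1: "\<bar>orb s \<kappa> t $ 5 - s * (sin (\<alpha> * t) / \<alpha>)\<bar> \<le> \<eta>' * s"
      by (simp add: lin_orbit_5)
    have "\<bar>L (orb s \<kappa> t - s *\<^sub>R lin_orbit \<kappa> t) $ 5\<bar> \<le> B * (\<eta>' * s)"
      using component_le_norm_cart[of "L (orb s \<kappa> t - s *\<^sub>R lin_orbit \<kappa> t)" 5]
        B(2)[of "orb s \<kappa> t - s *\<^sub>R lin_orbit \<kappa> t"] mult_left_mono[OF n[THEN conjunct1], of B] B(1) by linarith
    then have 2: "\<bar>L (orb s \<kappa> t) $ 5 - s * cos (\<alpha> * t)\<bar> \<le> (B * \<eta>') * s"
      by (simp add: linear_diff[OF linear_L] linear_scale[OF linear_L] L_lin_orbit_5 mult.assoc)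
    have 3: "\<bar>F x $ 5 - s * cos (\<alpha> * t)\<bar> \<le> (B * \<eta>' + \<eta>') * s"
      if "norm x \<le> norm (orb s \<kappa> t)" "L x $ 5 = L (orb s \<kappa> t) $ 5" for x
    proof -
      have "\<bar>(F x - L x) $ 5\<bar> \<le> \<eta>' * s"
        using n that(1) component_le_norm_cart order.trans by blast
      then show ?thesis using 2 that(2) by (simp add: algebra_simps)
    qed
    show "\<bar>orb s \<kappa> t $ 5 - s * (sin (\<alpha> * t) / \<alpha>)\<bar> \<le> \<eta> * s \<and>
      \<bar>L (orb s \<kappa> t) $ 5 - s * cos (\<alpha> * t)\<bar> \<le> \<eta> * s \<and> norm (orb s \<kappa> t) < r \<and>
      (\<forall>x. norm x \<le> norm (orb s \<kappa> t) \<and> L x $ 5 = L (orb s \<kappa> t) $ 5 \<longrightarrow> \<bar>F x $ 5 - s * cos (\<alpha> * t)\<bar> \<le> \<eta> * s)"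
      using scale[OF 1 \<eta>'(4)] scale[OF 2 \<eta>'(3)] n scale[OF 3 \<eta>'(2)] by blast
  qed
qed

lemma flow_reversible:
  assumes "R2 x = x"
  shows "\<psi> x (- t) = R2 (\<psi> x t)"
proof -
  have "R2 (\<psi> x (- t)) = \<psi> x t" for t
  proof (rule flow_unique)
    fix t
    have "(uminus has_vector_derivative (- 1 :: real)) (at t)"
      by (auto intro!: derivative_eq_intros)
    from vector_diff_chain_at[OF this flow[of x]]
    have "((\<lambda>t. \<psi> x (- t)) has_vector_derivative - F (\<psi> x (- t))) (at t)"
      by (simp add: o_def)
    then have "((\<lambda>t. R2 (\<psi> x (- t))) has_vector_derivative R2 (- F (\<psi> x (- t)))) (at t)"
      using linear_R2 linear_conv_bounded_linear bounded_linear.has_vector_derivative by blast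
    then show "((\<lambda>t. R2 (\<psi> x (- t))) has_vector_derivative F (R2 (\<psi> x (- t)))) (at t)"
      by (simp add: reversible linear_neg[OF linear_R2])
  qed (simp add: start assms)
  from this[of "t"] show ?thesis by (metis R2_R2)
qed

text \<open>By uniqueness the orbit is symmetric under time reversal about \<open>0\<close> and about \<open>T\<close>, hence
  invariant under the translation by \<open>2 T\<close>.\<close>

lemma fixed_twice_imp_periodic:
  assumes "R2 x = x" "R2 (\<psi> x T) = \<psi> x T"
  shows "\<psi> x (t + 2 * T) = \<psi> x t"
proof -
  have "\<psi> x (T + v) = R2 (\<psi> x (T - v))" for v
    using flow_reversible[OF assms(2), of "- v"] flow_shift[of x v T] flow_shift[of x "- v" T]
    by (simp add: add.commute)
  from this[of "T + t"] have "\<psi> x (T + (T + t)) = R2 (\<psi> x (- t))" by simp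
  also have "\<dots> = \<psi> x t" using flow_reversible[OF assms(1), of t] by simp
  finally show ?thesis by (simp add: algebra_simps)
qed

lemma has_derivative_H: "x \<in> ball 0 r \<Longrightarrow> (H has_derivative (\<lambda>h. \<Sum>j\<in>UNIV. h $ j *\<^sub>R partials [j] H x)) (at x)"
  by (rule smooth_on_has_derivative[OF smooth_H])

text \<open>Reversibility makes the symmetric velocity components vanish on the fixed space, and these are
  the derivatives of \<open>H\<close> along it.\<close>

lemma H_fixed: assumes "R2 x = x" "x \<in> ball 0 r" shows "H x = H 0"
proof -
  have d: "((\<lambda>t. H (t *\<^sub>R x)) has_real_derivative 0) (at t)" if "t \<in> {0..1}" for t
  proof -
    have "norm (t *\<^sub>R x) \<le> norm x" using that mult_right_mono[of t 1 "norm x"] by simp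
    then have b: "t *\<^sub>R x \<in> ball 0 r" using assms(2) by simp
    have "R2 (t *\<^sub>R x) = t *\<^sub>R x" using assms(1) by (simp add: linear_scale[OF linear_R2])
    then have "F (t *\<^sub>R x) = - R2 (F (t *\<^sub>R x))" using reversible by metis
    then have F0: "F (t *\<^sub>R x) $ i = - (R2 (F (t *\<^sub>R x)) $ i)" for i by (metis vector_uminus_component)
    have "ham_vf H (t *\<^sub>R x) $ i = 0" if "i \<in> {1, 2, 3, 4}" for i
      using F0[of i] that hamiltonian[OF b] by auto
    then have p: "partials [1] H (t *\<^sub>R x) = 0" "partials [2] H (t *\<^sub>R x) = 0"
      "partials [3] H (t *\<^sub>R x) = 0" "partials [4] H (t *\<^sub>R x) = 0"
      using ham_vf_nth[of H "t *\<^sub>R x"] by auto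
    have "((\<lambda>t. t *\<^sub>R x) has_derivative (\<lambda>h. h *\<^sub>R x)) (at t)"
      by (auto intro!: derivative_eq_intros)
    from has_derivative_compose[OF this has_derivative_H[OF b]]
    have "((\<lambda>t. H (t *\<^sub>R x)) has_derivative (\<lambda>h. \<Sum>j\<in>UNIV. (h *\<^sub>R x) $ j *\<^sub>R partials [j] H (t *\<^sub>R x))) (at t)" .
    moreover have "(\<lambda>h. \<Sum>j\<in>UNIV. (h *\<^sub>R x) $ j *\<^sub>R partials [j] H (t *\<^sub>R x)) = (*) 0"
      using assms(1) by (simp add: sum_UNIV_6 p R2_fixed_iff fun_eq_iff)
    ultimately show ?thesis by (simp add: has_field_derivative_def)
  qed
  have "\<exists>c. \<forall>t\<in>{0..1}. H (t *\<^sub>R x) = c"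
    by (rule has_field_derivative_zero_constant) (auto intro: has_field_derivative_at_within[OF d])
  then have "H (1 *\<^sub>R x) = H (0 *\<^sub>R x)" by (metis atLeastAtMost_iff order.refl zero_le_one)
  then show ?thesis by simp
qed

lemma H_conserved:
  assumes "0 \<le> T" "\<And>t. 0 \<le> t \<Longrightarrow> t \<le> T \<Longrightarrow> \<psi> x t \<in> ball 0 r"
  shows "H (\<psi> x T) = H x"
proof -
  have d: "((\<lambda>t. H (\<psi> x t)) has_real_derivative 0) (at t)" if "t \<in> {0..T}" for t
  proof -
    have b: "\<psi> x t \<in> ball 0 r" using assms that by simp
    from has_derivative_compose[OF flow[of x t, unfolded has_vector_derivative_def] has_derivative_H[OF b]]
    have "((\<lambda>t. H (\<psi> x t)) has_derivative
       (\<lambda>h. \<Sum>j\<in>UNIV. (h *\<^sub>R F (\<psi> x t)) $ j *\<^sub>R partials [j] H (\<psi> x t))) (at t)" .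
    moreover have "(\<lambda>h. \<Sum>j\<in>UNIV. (h *\<^sub>R F (\<psi> x t)) $ j *\<^sub>R partials [j] H (\<psi> x t)) = (*) 0"
      by (simp add: sum_UNIV_6 hamiltonian[OF b] ham_vf_nth fun_eq_iff algebra_simps)
    ultimately show ?thesis by (simp add: has_field_derivative_def)
  qed
  have "\<exists>c. \<forall>t\<in>{0..T}. H (\<psi> x t) = c"
    by (rule has_field_derivative_zero_constant) (auto intro: has_field_derivative_at_within[OF d])
  then have "H (\<psi> x T) = H (\<psi> x 0)" using assms(1) by (metis atLeastAtMost_iff order.refl)
  then show ?thesis by (simp add: start)
qed

text \<open>The energy plays the role of the second shooting equation: on the segment that removes the sixth
  coordinate, the derivative of \<open>H\<close> in that direction is the fifth component of the velocity.
  If the latter does not vanish there, the segment is trivial, as \<open>H\<close> takes the same value at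
  both of its ends.\<close>

lemma fixed_if_energy_0:
  assumes "x \<in> ball 0 r" "H x = H 0" "x $ 5 = 0"
    and nz: "\<And>\<xi>. norm \<xi> \<le> norm x \<Longrightarrow> L \<xi> $ 5 = L x $ 5 \<Longrightarrow> F \<xi> $ 5 \<noteq> 0"
  shows "R2 x = x"
proof (rule ccontr)
  assume "R2 x \<noteq> x"
  then have x6: "x $ 6 \<noteq> 0" using assms(3) by (simp add: R2_fixed_iff)
  define y where "y t = x - ((1 - t) * x $ 6) *\<^sub>R axis 6 1" for t
  have norm_y: "norm (y t) \<le> norm x" if "0 \<le> t" "t \<le> 1" for t
  proof -
    have "\<bar>y t $ i\<bar> \<le> \<bar>x $ i\<bar>" for i
    proof (cases "i = 6")
      case True
      have "y t $ 6 = t * x $ 6" by (simp add: y_def axis_def algebra_simps)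
      then show ?thesis using that True mult_right_mono[of t 1 "\<bar>x $ 6\<bar>"] by (simp add: abs_mult)
    qed (simp add: y_def axis_def)
    then show ?thesis by (simp add: norm_le_componentwise_cart)
  qed
  have d: "((\<lambda>t. H (y t)) has_real_derivative x $ 6 * F (y t) $ 5) (at t)" if "0 \<le> t" "t \<le> 1" for t
  proof -
    have b: "y t \<in> ball 0 r" using norm_y[OF that] assms(1) by simp
    have "(y has_derivative (\<lambda>h. h *\<^sub>R (x $ 6 *\<^sub>R axis 6 1))) (at t)"
      unfolding y_def by (auto intro!: derivative_eq_intros simp: algebra_simps fun_eq_iff)
    from has_derivative_compose[OF this has_derivative_H[OF b]]
    have "((\<lambda>t. H (y t)) has_derivative
       (\<lambda>h. \<Sum>j\<in>UNIV. (h *\<^sub>R (x $ 6 *\<^sub>R axis 6 1)) $ j *\<^sub>R partials [j] H (y t))) (at t)" .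
    moreover have "(\<lambda>h. \<Sum>j\<in>UNIV. (h *\<^sub>R (x $ 6 *\<^sub>R axis 6 1)) $ j *\<^sub>R partials [j] H (y t)) = (*) (x $ 6 * F (y t) $ 5)"
      by (simp add: sum_UNIV_6 hamiltonian[OF b] ham_vf_nth fun_eq_iff axis_def)
    ultimately show ?thesis by (simp add: has_field_derivative_def)
  qed
  have "\<exists>t>0. t < 1 \<and> H (y 1) - H (y 0) = (1 - 0) * (x $ 6 * F (y t) $ 5)"
    by (rule MVT2) (use d in auto)
  then obtain t where t: "0 < t" "t < 1" "H (y 1) - H (y 0) = x $ 6 * F (y t) $ 5" by auto
  have "R2 (y 0) = y 0" using assms(3) by (simp add: R2_fixed_iff y_def axis_def)
  then have "H (y 0) = H 0" using norm_y[of 0] assms(1) by (intro H_fixed) auto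
  moreover have "y 1 = x" by (simp add: y_def)
  ultimately have "F (y t) $ 5 = 0" using t(3) assms(2) x6 by simp
  moreover have "L (y t) $ 5 = L x $ 5"
  proof -
    have "L (((1 - t) * x $ 6) *\<^sub>R axis 6 1) $ 5 = 0"
      by (rule L_antisymmetric_5) (simp_all add: axis_def)
    then show ?thesis by (simp add: y_def linear_diff[OF linear_L])
  qed
  ultimately show False using nz[OF norm_y] t by simp
qed

text \<open>The first return time to the fixed space. It is characterized by the sign of the fifth
  component before and after \<open>T\<close>; the sign of \<open>(L x)\<^sub>5\<close> at the return point is opposite
  to its sign at the start and tells the two points apart. The last clause keeps the orbit, for
  more than a period, in the ball where the field is Hamiltonian.\<close>

definition half_period :: "real \<Rightarrow> real \<Rightarrow> real \<Rightarrow> bool" where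
  "half_period s \<kappa> T \<longleftrightarrow> 2 * pi / 3 < \<alpha> * T \<and> \<alpha> * T < 4 * pi / 3 \<and> R2 (orb s \<kappa> T) = orb s \<kappa> T \<and>
     (\<forall>t. 0 < t \<and> t < T \<longrightarrow> 0 < orb s \<kappa> t $ 5) \<and>
     (\<forall>t. T < t \<and> \<alpha> * t \<le> 4 * pi / 3 \<longrightarrow> orb s \<kappa> t $ 5 < 0) \<and>
     L (orb s \<kappa> T) $ 5 < 0 \<and>
     (\<forall>t. 0 \<le> t \<and> \<alpha> * t \<le> 3 * pi \<longrightarrow> norm (orb s \<kappa> t) < r)"

lemma half_period_exists:
  obtains s1 where "0 < s1"
    "\<And>s \<kappa>. 0 < s \<Longrightarrow> s < s1 \<Longrightarrow> \<bar>\<kappa>\<bar> \<le> slope_max \<Longrightarrow> \<exists>T. half_period s \<kappa> T"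
proof -
  define \<eta> where "\<eta> = min (1 / 4) (1 / (4 * \<alpha>))"
  have "0 < \<eta>" using \<alpha>_pos by (simp add: \<eta>_def)
  obtain s1 where s1: "0 < s1" "\<And>s \<kappa> t. 0 < s \<Longrightarrow> s < s1 \<Longrightarrow> \<bar>\<kappa>\<bar> \<le> slope_max \<Longrightarrow> 0 \<le> t \<Longrightarrow> t \<le> 3 * pi / \<alpha> \<Longrightarrow>
    \<bar>orb s \<kappa> t $ 5 - s * (sin (\<alpha> * t) / \<alpha>)\<bar> \<le> \<eta> * s \<and>
    \<bar>L (orb s \<kappa> t) $ 5 - s * cos (\<alpha> * t)\<bar> \<le> \<eta> * s \<and> norm (orb s \<kappa> t) < r \<and>
    (\<forall>x. norm x \<le> norm (orb s \<kappa> t) \<and> L x $ 5 = L (orb s \<kappa> t) $ 5 \<longrightarrow> \<bar>F x $ 5 - s * cos (\<alpha> * t)\<bar> \<le> \<eta> * s)"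
    using orb_near_oscillation[OF \<open>0 < \<eta>\<close>] by metis
  show thesis
  proof (rule that[OF s1(1)])
    fix s \<kappa> assume s: "0 < s" "s < s1" "\<bar>\<kappa>\<bar> \<le> slope_max"
    have time: "t \<le> 3 * pi / \<alpha> \<longleftrightarrow> \<alpha> * t \<le> 3 * pi" for t
      using \<alpha>_pos by (simp add: field_simps)
    have le: "\<alpha> * t \<le> 3 * pi" if "\<alpha> * t \<le> 4 * pi / 3" for t
      using that pi_gt_zero by linarith
    have \<eta>s: "\<eta> * s \<le> s / 4" "\<eta> * s \<le> s / (4 * \<alpha>)"
      using s(1) mult_right_mono[of \<eta> "1 / 4" s] mult_right_mono[of \<eta> "1 / (4 * \<alpha>)" s]
      by (auto simp: \<eta>_def)
    note near = s1(2)[OF s, unfolded time]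
    obtain T where T: "2 * pi / 3 < \<alpha> * T" "\<alpha> * T < 4 * pi / 3" "orb s \<kappa> T $ 5 = 0"
      "\<And>t. 0 < t \<Longrightarrow> t < T \<Longrightarrow> 0 < orb s \<kappa> t $ 5"
      "\<And>t. T < t \<Longrightarrow> \<alpha> * t \<le> 4 * pi / 3 \<Longrightarrow> orb s \<kappa> t $ 5 < 0"
    proof (rule near_sine_first_zero[OF \<alpha>_pos s(1), of "\<lambda>t. orb s \<kappa> t $ 5" "\<lambda>t. F (orb s \<kappa> t) $ 5"])
      have "R2 (orb s \<kappa> 0) = orb s \<kappa> 0" by (simp add: orb_def start)
      then show "orb s \<kappa> 0 $ 5 = 0" by (simp add: R2_fixed_iff)
      fix t assume t: "0 \<le> t" "\<alpha> * t \<le> 4 * pi / 3"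
      show "((\<lambda>t. orb s \<kappa> t $ 5) has_real_derivative F (orb s \<kappa> t) $ 5) (at t)"
        unfolding has_real_derivative_iff_has_vector_derivative orb_def
        by (rule bounded_linear.has_vector_derivative[OF bounded_linear_vec_nth flow])
      show "\<bar>orb s \<kappa> t $ 5 - s * (sin (\<alpha> * t) / \<alpha>)\<bar> \<le> s / (4 * \<alpha>)"
        using near[OF t(1) le[OF t(2)]] \<eta>s by linarith
      show "\<bar>F (orb s \<kappa> t) $ 5 - s * cos (\<alpha> * t)\<bar> \<le> s / 4"
      proof -
        have "\<bar>F (orb s \<kappa> t) $ 5 - s * cos (\<alpha> * t)\<bar> \<le> \<eta> * s"
          using near[OF t(1) le[OF t(2)]] by blast
        then show ?thesis using \<eta>s(1) by linarith
      qed
    qed blast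
    have "0 < \<alpha> * T" using T(1) pi_gt_zero by linarith
    then have "0 < T" using \<alpha>_pos by (simp add: zero_less_mult_iff)
    have T3: "\<alpha> * T \<le> 3 * pi" using le T(2) by simp
    note nearT = near[OF less_imp_le[OF \<open>0 < T\<close>] T3]
    have cosT: "s * cos (\<alpha> * T) \<le> - (s / 2)"
    proof -
      have "\<bar>\<alpha> * T - pi\<bar> \<le> pi / 3" using T by (intro abs_leI) linarith+
      then have "cos (pi / 3) \<le> cos \<bar>\<alpha> * T - pi\<bar>"
        using pi_gt_zero by (intro cos_monotone_0_pi_le) auto
      then have "cos (\<alpha> * T) \<le> - (1 / 2)" by (simp add: cos_60 cos_diff)
      then have "s * cos (\<alpha> * T) \<le> s * - (1 / 2)" using s(1) by (intro mult_left_mono) auto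
      then show ?thesis by simp
    qed
    have small_orb: "norm (orb s \<kappa> t) < r" if "0 \<le> t" "\<alpha> * t \<le> 3 * pi" for t
      using near[OF that] by blast
    have "R2 (orb s \<kappa> T) = orb s \<kappa> T"
    proof (rule fixed_if_energy_0)
      show "orb s \<kappa> T \<in> ball 0 r" using nearT by simp
      have "norm (orb s \<kappa> 0) < r" using small_orb[of 0] pi_gt_zero by simp
      then have "H (s *\<^sub>R direction \<kappa>) = H 0" by (intro H_fixed) (simp_all add: orb_def start)
      moreover have "H (orb s \<kappa> T) = H (s *\<^sub>R direction \<kappa>)"
        unfolding orb_def
      proof (rule H_conserved)
        fix t assume t: "0 \<le> t" "t \<le> T"
        then have "\<alpha> * t \<le> \<alpha> * T" using \<alpha>_pos by simp
        then show "\<psi> (s *\<^sub>R direction \<kappa>) t \<in> ball 0 r" using small_orb[of t] t T3 by (simp add: orb_def)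
      qed (use \<open>0 < T\<close> in simp)
      ultimately show "H (orb s \<kappa> T) = H 0" by simp
      show "orb s \<kappa> T $ 5 = 0" by (rule T)
      fix \<xi> assume "norm \<xi> \<le> norm (orb s \<kappa> T)" "L \<xi> $ 5 = L (orb s \<kappa> T) $ 5"
      then have "\<bar>F \<xi> $ 5 - s * cos (\<alpha> * T)\<bar> \<le> \<eta> * s" using nearT by blast
      then show "F \<xi> $ 5 \<noteq> 0" using cosT \<eta>s(1) s(1) by linarith
    qed
    moreover have "L (orb s \<kappa> T) $ 5 < 0" using nearT cosT \<eta>s(1) s(1) by linarith
    ultimately have "half_period s \<kappa> T"
      using T small_orb by (simp add: half_period_def)
    then show "\<exists>T. half_period s \<kappa> T" ..
  qed
qed

text \<open>Just before and just after phase \<open>\<pi>\<close> the fifth component has the sign of the sine once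
  \<open>s\<close> is small, and \<open>T\<close> is where the sign changes.\<close>

lemma half_period_tendsto:
  assumes "\<bar>\<kappa>\<bar> \<le> slope_max" "0 < s1" and T: "\<And>s. 0 < s \<Longrightarrow> s < s1 \<Longrightarrow> half_period s \<kappa> (T s)"
  shows "(T \<longlongrightarrow> pi / \<alpha>) (at_right 0)"
proof (rule tendstoI)
  fix e :: real assume "0 < e"
  define \<delta> where "\<delta> = min e (pi / (4 * \<alpha>))"
  have \<delta>: "0 < \<delta>" "\<delta> \<le> e" "\<alpha> * \<delta> \<le> pi / 4" "0 < \<alpha> * \<delta>"
  proof -
    show "0 < \<delta>" "\<delta> \<le> e" using \<open>0 < e\<close> \<alpha>_pos by (auto simp: \<delta>_def)
    then show "0 < \<alpha> * \<delta>" using \<alpha>_pos by simp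
    have "\<alpha> * \<delta> \<le> \<alpha> * (pi / (4 * \<alpha>))" using \<alpha>_pos by (intro mult_left_mono) (auto simp: \<delta>_def)
    then show "\<alpha> * \<delta> \<le> pi / 4" using \<alpha>_pos by simp
  qed
  define \<eta> where "\<eta> = sin (\<alpha> * \<delta>) / \<alpha> / 2"
  have "0 < sin (\<alpha> * \<delta>)" using \<delta> pi_gt_zero by (intro sin_gt_zero) linarith+
  then have "0 < \<eta>" using \<alpha>_pos by (simp add: \<eta>_def)
  obtain s2 where s2: "0 < s2" "\<And>s t. 0 < s \<Longrightarrow> s < s2 \<Longrightarrow> 0 \<le> t \<Longrightarrow> t \<le> 3 * pi / \<alpha> \<Longrightarrow>
    \<bar>orb s \<kappa> t $ 5 - s * (sin (\<alpha> * t) / \<alpha>)\<bar> \<le> \<eta> * s"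
    using orb_near_oscillation[OF \<open>0 < \<eta>\<close>] assms(1) by metis
  have "dist (T s) (pi / \<alpha>) < e" if s: "0 < s" "s < min s1 s2" for s
  proof -
    let ?a = "pi / \<alpha> - \<delta>" and ?b = "pi / \<alpha> + \<delta>"
    have a: "\<alpha> * ?a = pi - \<alpha> * \<delta>" and b: "\<alpha> * ?b = pi + \<alpha> * \<delta>"
      using \<alpha>_pos by (simp_all add: algebra_simps)
    have time: "t \<le> 3 * pi / \<alpha> \<longleftrightarrow> \<alpha> * t \<le> 3 * pi" "0 \<le> t \<longleftrightarrow> 0 \<le> \<alpha> * t" for t
      using \<alpha>_pos by (simp_all add: field_simps zero_le_mult_iff)
    have S: "s * (sin (\<alpha> * \<delta>) / \<alpha>) = 2 * (\<eta> * s)" by (simp add: \<eta>_def)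
    have S': "0 < \<eta> * s" using \<open>0 < \<eta>\<close> s by simp
    have "\<bar>orb s \<kappa> ?a $ 5 - s * (sin (\<alpha> * ?a) / \<alpha>)\<bar> \<le> \<eta> * s"
    proof (rule s2(2))
      have "0 \<le> \<alpha> * ?a" "\<alpha> * ?a \<le> 3 * pi"
        unfolding a using \<delta> pi_gt_zero by linarith+
      then show "0 \<le> ?a" "?a \<le> 3 * pi / \<alpha>"
        using time by blast+
    qed (use s in auto)
    moreover have "sin (\<alpha> * ?a) = sin (\<alpha> * \<delta>)" unfolding a by simp
    ultimately have "\<bar>orb s \<kappa> ?a $ 5 - 2 * (\<eta> * s)\<bar> \<le> \<eta> * s" by (simp only: S)
    then have ya: "0 < orb s \<kappa> ?a $ 5" using S' by linarith
    have "\<bar>orb s \<kappa> ?b $ 5 - s * (sin (\<alpha> * ?b) / \<alpha>)\<bar> \<le> \<eta> * s"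
    proof (rule s2(2))
      have "0 \<le> \<alpha> * ?b" "\<alpha> * ?b \<le> 3 * pi"
        unfolding b using \<delta> pi_gt_zero by linarith+
      then show "0 \<le> ?b" "?b \<le> 3 * pi / \<alpha>"
        using time by blast+
    qed (use s in auto)
    moreover have "sin (\<alpha> * ?b) = - sin (\<alpha> * \<delta>)" unfolding b by (simp add: sin_add)
    moreover have "s * (- sin (\<alpha> * \<delta>) / \<alpha>) = - (2 * (\<eta> * s))" using S by simp
    ultimately have "\<bar>orb s \<kappa> ?b $ 5 - - (2 * (\<eta> * s))\<bar> \<le> \<eta> * s" by (simp only:)
    then have yb: "orb s \<kappa> ?b $ 5 < 0" using S' by linarith
    have h: "half_period s \<kappa> (T s)" using T s by simp
    have "T s > ?a"
    proof (rule ccontr)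
      assume "\<not> ?thesis"
      moreover have "T s \<noteq> ?a" using h ya by (auto simp: half_period_def R2_fixed_iff)
      ultimately have "orb s \<kappa> ?a $ 5 < 0"
        using h a \<delta> pi_gt_zero by (auto simp: half_period_def)
      then show False using ya by simp
    qed
    moreover have "T s < ?b"
    proof (rule ccontr)
      assume "\<not> ?thesis"
      moreover have "T s \<noteq> ?b" using h yb by (auto simp: half_period_def R2_fixed_iff)
      moreover have "0 < ?b" using \<alpha>_pos \<delta>(1) by (simp add: add_pos_pos)
      ultimately have "0 < orb s \<kappa> ?b $ 5"
        using h by (auto simp: half_period_def)
      then show False using yb by simp
    qed
    ultimately show ?thesis using \<delta>(2) by (simp add: dist_real_def abs_less_iff)
  qed
  then show "\<forall>\<^sub>F s in at_right 0. dist (T s) (pi / \<alpha>) < e"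
    unfolding eventually_at_right_field using s2(1) assms(2)
    by (intro exI[of _ "min s1 s2"]) auto
qed

context
  fixes s \<kappa> T assumes s: "0 < s" and h: "half_period s \<kappa> T"
begin

lemma T_pos: "0 < T"
proof -
  have "0 < \<alpha> * T" using h pi_gt_zero by (auto simp: half_period_def)
  then show ?thesis using \<alpha>_pos by (simp add: zero_less_mult_iff)
qed

lemma orb_periodic: "orb s \<kappa> (t + 2 * T) = orb s \<kappa> t"
  using fixed_twice_imp_periodic[of "s *\<^sub>R direction \<kappa>" T t] h by (simp add: half_period_def orb_def)

lemma orb_fixed_only: assumes "0 < t" "t < T" shows "R2 (orb s \<kappa> t) \<noteq> orb s \<kappa> t"
  using assms h by (force simp: half_period_def R2_fixed_iff)

text \<open>By reversibility, a period \<open>S\<close> brings the orbit back to the fixed space already at time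
  \<open>S/2\<close>, which cannot happen before \<open>T\<close>.\<close>

lemma orb_has_period: "has_period (orb s \<kappa>) (2 * T)"
  unfolding has_period_def
proof (intro conjI allI impI)
  fix S assume S: "0 < S \<and> (\<forall>t. orb s \<kappa> (t + S) = orb s \<kappa> t)"
  show "2 * T \<le> S"
  proof (rule ccontr)
    assume "\<not> ?thesis"
    have "R2 (orb s \<kappa> (S / 2)) = orb s \<kappa> (- (S / 2))"
      unfolding orb_def by (rule flow_reversible[symmetric]) simp
    also have "\<dots> = orb s \<kappa> (- (S / 2) + S)" using S by metis
    finally have "R2 (orb s \<kappa> (S / 2)) = orb s \<kappa> (S / 2)" by simp
    then show False using orb_fixed_only[of "S / 2"] S \<open>\<not> 2 * T \<le> S\<close> by simp
  qed
qed (use T_pos orb_periodic in auto)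

lemma orb_mod_period: obtains t' where "0 \<le> t'" "t' < 2 * T" "orb s \<kappa> t = orb s \<kappa> t'"
proof -
  have n: "orb s \<kappa> (t + real n * (2 * T)) = orb s \<kappa> t" for n t
  proof (induction n)
    case (Suc n)
    then show ?case using orb_periodic[of "t + real n * (2 * T)"] by (simp add: algebra_simps)
  qed simp
  have int: "orb s \<kappa> (t + of_int k * (2 * T)) = orb s \<kappa> t" for k :: int and t
  proof (cases "0 \<le> k")
    case True
    then show ?thesis using n[of t "nat k"] by simp
  next
    case False
    then show ?thesis using n[of "t + of_int k * (2 * T)" "nat (- k)"] by (simp add: algebra_simps)
  qed
  define k where "k = \<lfloor>t / (2 * T)\<rfloor>"
  have k: "of_int k * (2 * T) \<le> t" "t < (of_int k + 1) * (2 * T)"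
  proof -
    have "of_int k \<le> t / (2 * T)" "t / (2 * T) < of_int k + 1" unfolding k_def by linarith+
    then show "of_int k * (2 * T) \<le> t" "t < (of_int k + 1) * (2 * T)"
      using T_pos by (simp_all only: pos_le_divide_eq pos_divide_less_eq mult_pos_pos zero_less_numeral)
  qed
  show thesis
  proof
    show "orb s \<kappa> t = orb s \<kappa> (t + of_int (- k) * (2 * T))" using int by metis
  qed (use k in \<open>auto simp: algebra_simps\<close>)
qed

lemma orb_norm_bound:
  assumes "\<bar>\<kappa>\<bar> \<le> slope_max"
  shows "norm (orb s \<kappa> t) \<le> s * ((norm u + slope_max * norm z) * growth)" "norm (orb s \<kappa> t) < r"
proof -
  obtain t' where t': "0 \<le> t'" "t' < 2 * T" "orb s \<kappa> t = orb s \<kappa> t'" by (rule orb_mod_period)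
  have "\<alpha> * t' \<le> \<alpha> * (2 * T)" using t' \<alpha>_pos by simp
  also have "\<dots> \<le> 3 * pi" using h pi_gt_zero by (auto simp: half_period_def)
  finally have "\<alpha> * t' \<le> 3 * pi" .
  then show "norm (orb s \<kappa> t) < r" using h t' by (auto simp: half_period_def)
  have "t' \<le> 3 * pi / \<alpha>" using \<open>\<alpha> * t' \<le> 3 * pi\<close> \<alpha>_pos by (simp add: field_simps)
  then show "norm (orb s \<kappa> t) \<le> s * ((norm u + slope_max * norm z) * growth)"
    using orb_bound[OF assms, of s t'] t' s by simp
qed

text \<open>An orbit meets the fixed space twice per period, at its start and at its return point. The
  functional \<open>(L x)\<^sub>5\<close> is positive at every starting point but negative at return points.\<close>

lemma start_in_orbit:
  assumes "0 < s'" "s' *\<^sub>R direction \<kappa>' \<in> range (orb s \<kappa>)"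
  shows "s' *\<^sub>R direction \<kappa>' = s *\<^sub>R direction \<kappa>"
proof -
  obtain t where t: "s' *\<^sub>R direction \<kappa>' = orb s \<kappa> t" using assms(2) by auto
  obtain t' where t': "0 \<le> t'" "t' < 2 * T" "orb s \<kappa> t = orb s \<kappa> t'" by (rule orb_mod_period)
  have fixed: "R2 (orb s \<kappa> t') = orb s \<kappa> t'" using t t' R2_direction by metis
  have "L (orb s \<kappa> t') $ 5 = s'"
    using t t' by (simp add: linear_scale[OF linear_L] L_direction axis_5_5 flip: t'(3) t)
  then have "t' \<noteq> T" using h assms(1) by (auto simp: half_period_def)
  moreover have "\<not> (0 < t' \<and> t' < T)" using orb_fixed_only fixed by blast
  moreover have "\<not> T < t'"
  proof
    assume "T < t'"
    have "orb s \<kappa> (2 * T - t') = orb s \<kappa> (- t')" using orb_periodic[of "- t'"] by (simp add: algebra_simps)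
    also have "\<dots> = R2 (orb s \<kappa> t')" unfolding orb_def by (rule flow_reversible) simp
    finally have "R2 (orb s \<kappa> (2 * T - t')) = orb s \<kappa> (2 * T - t')" using fixed by simp
    then show False using orb_fixed_only[of "2 * T - t'"] \<open>T < t'\<close> t' by simp
  qed
  ultimately have "t' = 0" using t' by linarith
  then show ?thesis using t t' by (simp add: orb_def start)
qed

end

lemma scaled_direction_inj:
  assumes "s' *\<^sub>R direction \<kappa>' = s *\<^sub>R direction \<kappa>" "s \<noteq> 0"
  shows "s' = s" "\<kappa>' = \<kappa>"
proof -
  have "L (s' *\<^sub>R direction \<kappa>') $ 5 = L (s *\<^sub>R direction \<kappa>) $ 5" using assms by simp
  then show "s' = s" by (simp add: linear_scale[OF linear_L] L_direction axis_5_5)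
  then have "direction \<kappa>' = direction \<kappa>" using assms by simp
  then show "\<kappa>' = \<kappa>" using z(3) by (simp add: direction_def)
qed

lemma orb_range_inj:
  assumes "0 < s" "0 < s'" "half_period s \<kappa> T" "range (orb s \<kappa>) = range (orb s' \<kappa>')"
  shows "s' = s" "\<kappa>' = \<kappa>"
proof -
  have "s' *\<^sub>R direction \<kappa>' = orb s' \<kappa>' 0" by (simp add: orb_def start)
  then have "s' *\<^sub>R direction \<kappa>' \<in> range (orb s \<kappa>)" using assms(4) by auto
  then have "s' *\<^sub>R direction \<kappa>' = s *\<^sub>R direction \<kappa>"
    by (rule start_in_orbit[OF assms(1,3,2)])
  then show "s' = s" "\<kappa>' = \<kappa>"
    using scaled_direction_inj assms(1) by blast+
qed

lemma continuous_on_orb: "continuous_on UNIV (\<lambda>(s, \<kappa>, t). orb s \<kappa> t)"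
proof -
  have "continuous_on UNIV (\<lambda>p. (\<lambda>(x, t). \<psi> x t) (fst p *\<^sub>R direction (fst (snd p)), snd (snd p)))"
    by (rule continuous_on_compose2[OF continuous_on_flow])
       (auto simp: direction_def intro!: continuous_intros)
  then show ?thesis by (simp add: case_prod_unfold orb_def)
qed

theorem orb_families:
  assumes FX: "\<And>x. x \<in> ball 0 r \<Longrightarrow> X x = F x"
  shows "has_two_periodic_families X \<alpha>"
proof -
  obtain \<epsilon> where \<epsilon>: "0 < \<epsilon>" "\<And>s \<kappa>. 0 < s \<Longrightarrow> s < \<epsilon> \<Longrightarrow> \<bar>\<kappa>\<bar> \<le> slope_max \<Longrightarrow> \<exists>T. half_period s \<kappa> T"
    using half_period_exists by metis
  then obtain T where T: "\<And>s \<kappa>. 0 < s \<Longrightarrow> s < \<epsilon> \<Longrightarrow> \<bar>\<kappa>\<bar> \<le> slope_max \<Longrightarrow> half_period s \<kappa> (T s \<kappa>)" by metis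
  \<comment> \<open>The families depend on \<open>\<bar>\<sigma>\<bar>\<close> only; \<open>\<sigma>\<close> and \<open>- \<sigma>\<close> give the same orbit.\<close>
  define \<gamma> where "\<gamma> k \<sigma> l = orb \<bar>\<sigma>\<bar> (k l)" for k :: "real \<Rightarrow> real" and \<sigma> l
  define P where "P k \<sigma> l = 2 * T \<bar>\<sigma>\<bar> (k l)" for k :: "real \<Rightarrow> real" and \<sigma> l
  define adm where "adm k \<longleftrightarrow> continuous_on UNIV k \<and> inj k \<and> (\<forall>l\<in>{0..2*pi}. \<bar>k l\<bar> \<le> slope_max)" for k :: "real \<Rightarrow> real"
  have hp: "half_period \<bar>\<sigma>\<bar> (k l) (T \<bar>\<sigma>\<bar> (k l))"
    if "adm k" "\<sigma> \<in> {-\<epsilon><..<\<epsilon>} - {0}" "l \<in> {0..2*pi}" for k \<sigma> l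
    using that by (intro T) (auto simp: adm_def)
  have family: "periodic_family X \<epsilon> (\<gamma> k) (P k)" if k: "adm k" for k
    unfolding periodic_family_def
  proof (intro conjI ballI)
    have "continuous_on UNIV (\<lambda>p. (\<lambda>(s, \<kappa>, t). orb s \<kappa> t) (\<bar>fst p\<bar>, k (fst (snd p)), snd (snd p)))"
      by (rule continuous_on_compose2[OF continuous_on_orb])
         (use k in \<open>auto simp: adm_def intro!: continuous_intros continuous_on_compose2[of UNIV k]\<close>)
    then have "continuous_on UNIV (\<lambda>(\<sigma>, l, t). \<gamma> k \<sigma> l t)"
      by (simp add: case_prod_unfold \<gamma>_def)
    then show "continuous_on ({-\<epsilon><..<\<epsilon>} \<times> {0..2*pi} \<times> UNIV) (\<lambda>(\<sigma>, l, t). \<gamma> k \<sigma> l t)"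
      by (rule continuous_on_subset) simp
  next
    fix \<sigma> l assume \<sigma>: "\<sigma> \<in> {-\<epsilon><..<\<epsilon>}" "l \<in> {0..2*pi}"
    have "\<gamma> k \<sigma> l t \<in> ball 0 r" for t
    proof (cases "\<sigma> = 0")
      case True
      then show ?thesis using r_pos by (simp add: \<gamma>_def orb_def flow_0)
    next
      case False
      then show ?thesis
        using orb_norm_bound(2)[OF _ hp[OF k], of \<sigma> l t] \<sigma> k by (simp add: \<gamma>_def adm_def)
    qed
    then show "solution X (\<gamma> k \<sigma> l)"
      using FX flow unfolding solution_def \<gamma>_def orb_def by metis
  next
    fix \<sigma> l assume \<sigma>: "\<sigma> \<in> {-\<epsilon><..<\<epsilon>} - {0}" "l \<in> {0..2*pi}"
    show "has_period (\<gamma> k \<sigma> l) (P k \<sigma> l)"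
      unfolding \<gamma>_def P_def by (rule orb_has_period[OF _ hp[OF k \<sigma>]]) (use \<sigma> in auto)
  next
    have inj: "\<sigma> = \<sigma>' \<and> l = l'"
      if "range (\<gamma> k \<sigma> l) = range (\<gamma> k \<sigma>' l')" "\<sigma> \<in> {-\<epsilon><..<\<epsilon>} - {0}" "l \<in> {0..2*pi}"
        "\<sigma>' \<in> {-\<epsilon><..<\<epsilon>} - {0}" "l' \<in> {0..2*pi}" "sgn \<sigma> = sgn \<sigma>'" for \<sigma> l \<sigma>' l'
    proof -
      have "0 < \<bar>\<sigma>\<bar>" "0 < \<bar>\<sigma>'\<bar>" using that(2,4) by auto
      note eq = orb_range_inj[OF this hp[OF k that(2,3)] that(1)[unfolded \<gamma>_def]]
      have "\<sigma>' = \<sigma>"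
        using eq(1) that(6) by (auto simp: sgn_if abs_if split: if_splits)
      moreover have "l' = l" using eq(2) k by (auto simp: adm_def dest: injD)
      ultimately show ?thesis by simp
    qed
    show "inj_on (\<lambda>(\<sigma>, l). range (\<gamma> k \<sigma> l)) ({0<..<\<epsilon>} \<times> {0..<2*pi})"
    proof (rule inj_onI, clarify)
      fix \<sigma> l \<sigma>' l'
      assume "\<sigma> \<in> {0<..<\<epsilon>}" "l \<in> {0..<2*pi}" "\<sigma>' \<in> {0<..<\<epsilon>}" "l' \<in> {0..<2*pi}"
        and eq: "range (\<gamma> k \<sigma> l) = range (\<gamma> k \<sigma>' l')"
      then show "\<sigma> = \<sigma>' \<and> l = l'" by (intro inj[OF eq]) simp_all
    qed
    show "inj_on (\<lambda>(\<sigma>, l). range (\<gamma> k \<sigma> l)) ({-\<epsilon><..<0} \<times> {0..<2*pi})"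
    proof (rule inj_onI, clarify)
      fix \<sigma> l \<sigma>' l'
      assume "\<sigma> \<in> {-\<epsilon><..<0}" "l \<in> {0..<2*pi}" "\<sigma>' \<in> {-\<epsilon><..<0}" "l' \<in> {0..<2*pi}"
        and eq: "range (\<gamma> k \<sigma> l) = range (\<gamma> k \<sigma>' l')"
      then show "\<sigma> = \<sigma>' \<and> l = l'" by (intro inj[OF eq]) simp_all
    qed
  qed
  have shrink: "\<forall>\<^sub>F \<sigma> in at 0. range (\<gamma> k \<sigma> l) \<subseteq> ball 0 \<rho>" if k: "adm k" "l \<in> {0..2*pi}" "0 < \<rho>" for k l \<rho>
  proof -
    define C where "C = (norm u + slope_max * norm z) * growth + 1"
    have "0 < C" using pi_gt_zero by (simp add: C_def growth_def slope_max_def add_nonneg_pos)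
    have "range (\<gamma> k \<sigma> l) \<subseteq> ball 0 \<rho>" if "\<sigma> \<noteq> 0" "\<bar>\<sigma>\<bar> < min \<epsilon> (\<rho> / C)" for \<sigma>
    proof -
      have "norm (\<gamma> k \<sigma> l t) < \<rho>" for t
      proof -
        have "norm (\<gamma> k \<sigma> l t) \<le> \<bar>\<sigma>\<bar> * (C - 1)"
          using orb_norm_bound(1)[OF _ hp[OF k(1) _ k(2)], of \<sigma> t] that k by (simp add: \<gamma>_def C_def adm_def abs_less_iff)
        also have "\<dots> \<le> \<bar>\<sigma>\<bar> * C" by (intro mult_left_mono) auto
        also have "\<dots> < \<rho>" using that(2) \<open>0 < C\<close> by (simp add: field_simps)
        finally show ?thesis .
      qed
      then show ?thesis by auto
    qed
    then show ?thesis
      unfolding eventually_at using \<epsilon>(1) \<open>0 < C\<close> \<open>0 < \<rho>\<close>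
      by (intro exI[of _ "min \<epsilon> (\<rho> / C)"]) (auto simp: dist_real_def)
  qed
  have period: "((\<lambda>\<sigma>. P k \<sigma> l) \<longlongrightarrow> 2 * pi / \<alpha>) (at 0)" if k: "adm k" "l \<in> {0..2*pi}" for k l
  proof -
    have "((\<lambda>s. T s (k l)) \<longlongrightarrow> pi / \<alpha>) (at_right 0)"
      by (rule half_period_tendsto[OF _ \<epsilon>(1)]) (use T k in \<open>auto simp: adm_def\<close>)
    moreover have "filterlim (\<lambda>\<sigma>::real. \<bar>\<sigma>\<bar>) (at_right 0) (at 0)"
      unfolding filterlim_at by (auto intro!: tendsto_eq_intros simp: eventually_at_filter)
    ultimately have "((\<lambda>\<sigma>. T \<bar>\<sigma>\<bar> (k l)) \<longlongrightarrow> pi / \<alpha>) (at 0)" by (rule filterlim_compose)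
    then have "((\<lambda>\<sigma>. 2 * T \<bar>\<sigma>\<bar> (k l)) \<longlongrightarrow> 2 * (pi / \<alpha>)) (at 0)" by (intro tendsto_intros)
    then show ?thesis by (simp add: P_def)
  qed
  \<comment> \<open>Disjoint ranges of \<open>\<kappa>\<close> on \<open>{0..2*pi}\<close> keep the two families apart.\<close>
  define k1 k2 where "k1 l = l" and "k2 l = - 1 - l" for l :: real
  have adm: "adm k1" "adm k2"
    using pi_gt_zero by (auto simp: adm_def k1_def k2_def inj_def slope_max_def abs_if intro!: continuous_intros)
  have "range (\<gamma> k1 \<sigma> l) \<noteq> range (\<gamma> k2 \<sigma>' l')"
    if "\<sigma> \<in> {-\<epsilon><..<\<epsilon>} - {0}" "\<sigma>' \<in> {-\<epsilon><..<\<epsilon>} - {0}" "l \<in> {0..2*pi}" "l' \<in> {0..2*pi}" for \<sigma> \<sigma>' l l'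
  proof
    assume "range (\<gamma> k1 \<sigma> l) = range (\<gamma> k2 \<sigma>' l')"
    moreover have "0 < \<bar>\<sigma>\<bar>" "0 < \<bar>\<sigma>'\<bar>" using that(1,2) by auto
    ultimately have "k2 l' = k1 l"
      using orb_range_inj(2)[OF _ _ hp[OF adm(1) that(1,3)]] unfolding \<gamma>_def by blast
    then show False using that by (simp add: k1_def k2_def)
  qed
  then show ?thesis
    unfolding has_two_periodic_families_def
    using \<epsilon>(1) family[OF adm(1)] family[OF adm(2)] shrink[OF adm(1)] shrink[OF adm(2)]
      period[OF adm(1)] period[OF adm(2)]
    by (intro exI[of _ \<epsilon>] exI[of _ "\<gamma> k1"] exI[of _ "\<gamma> k2"] exI[of _ "P k1"] exI[of _ "P k2"] conjI) auto
qed

end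

section \<open>Periodic families of reversible Hamiltonian germs\<close>

text \<open>The involution is an isometry that preserves the ball, so composing with the nearest-point map
  does not destroy reversibility.\<close>

lemma closest_point_R2: "closest_point (cball 0 r) (R2 x) = R2 (closest_point (cball 0 r) x)" if "0 \<le> r"
proof (rule closest_point_unique[symmetric])
  have ne: "cball (0::real^6) r \<noteq> {}" using that by simp
  have "closest_point (cball 0 r) x \<in> cball 0 r"
    by (rule closest_point_in_set[OF closed_cball ne])
  then show "R2 (closest_point (cball 0 r) x) \<in> cball 0 r" by simp
  show "\<forall>z\<in>cball 0 r. dist (R2 x) (R2 (closest_point (cball 0 r) x)) \<le> dist (R2 x) z"
  proof
    fix z :: "real^6" assume "z \<in> cball 0 r"
    then have "dist x (closest_point (cball 0 r) x) \<le> dist x (R2 z)"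
      by (intro closest_point_le[OF closed_cball]) simp
    moreover have "dist (R2 v) w = dist v (R2 w)" for v w
      unfolding dist_norm by (metis R2_R2 linear_R2 linear_diff norm_R2)
    ultimately show "dist (R2 x) (R2 (closest_point (cball 0 r) x)) \<le> dist (R2 x) z" by simp
  qed
qed auto

theorem periodic_families_Omega2:
  assumes X: "X \<in> Omega2" and "0 < \<alpha>" and disc: "discriminant X = - \<alpha>\<^sup>2"
  shows "has_two_periodic_families X \<alpha>"
proof -
  obtain H r0 where H: "0 < r0" "smooth_on (ball 0 r0) H" "smooth_on (ball 0 r0) X"
    "\<And>x. x \<in> ball 0 r0 \<Longrightarrow> X x = ham_vf H x" "\<And>x. x \<in> ball 0 r0 \<Longrightarrow> X (R2 x) = - R2 (X x)"
    using Omega2_representative[OF X] by metis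
  define L where "L = linearization X"
  have X0: "X 0 = 0" using X by (simp add: Omega2_def)
  have L: "linear L" "L (R2 x) = - R2 (L x)" "L (L (L x)) = - (\<alpha>\<^sup>2) *\<^sub>R L x" for x
    unfolding L_def using linear_linearization linearization_R2[OF X] linearization_cube[OF X, of x] disc by auto
  have strict: "\<exists>r>0. cball (0 :: real^6) r \<subseteq> ball 0 r0 \<and> (\<forall>x\<in>cball 0 r. \<forall>y\<in>cball 0 r.
      norm ((X x - L x) - (X y - L y)) \<le> \<epsilon> * norm (x - y))" if "0 < \<epsilon>" for \<epsilon>
  proof -
    have mem: "0 \<in> ball (0 :: real^6) r0" using H(1) by simp
    show ?thesis
    proof (rule smooth_on_strict_derivative[OF open_ball mem H(3) that, folded linearization_def])
      fix r assume r: "0 < r" "cball (0 :: real^6) r \<subseteq> ball 0 r0"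
        "\<And>x y. x \<in> cball 0 r \<Longrightarrow> y \<in> cball 0 r \<Longrightarrow> norm ((X x - linearization X x) - (X y - linearization X y)) \<le> \<epsilon> * norm (x - y)"
      show ?thesis unfolding L_def by (intro exI[of _ r] conjI ballI r)
    qed
  qed
  obtain r where r: "0 < r" "cball (0 :: real^6) r \<subseteq> ball 0 r0"
    "\<forall>x\<in>cball 0 r. \<forall>y\<in>cball 0 r. norm ((X x - L x) - (X y - L y)) \<le> 1 * norm (x - y)"
    using strict[OF zero_less_one] by blast
  define P where "P = closest_point (cball (0::real^6) r)"
  have P: "P x \<in> cball 0 r" "norm (P x - P y) \<le> norm (x - y)" "x \<in> cball 0 r \<Longrightarrow> P x = x" "P (R2 x) = R2 (P x)" for x y
    using r(1) closest_point_in_set[of "cball 0 r" x] closest_point_lipschitz[of "cball 0 r" x y] closest_point_R2[of r x]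
    by (auto simp: P_def closest_point_self dist_norm)
  \<comment> \<open>The nonlinear part is frozen outside the ball, so that \<open>F\<close> is globally Lipschitz.\<close>
  define F where "F x = L x + (X (P x) - L (P x))" for x
  have FX: "F x = X x" if "x \<in> cball 0 r" for x using P(3)[OF that] by (simp add: F_def)
  obtain B where B: "0 < B" "\<And>x. norm (L x) \<le> B * norm x"
    using L(1) linear_conv_bounded_linear bounded_linear.pos_bounded by (metis mult.commute)
  have lip: "norm (F x - F y) \<le> (B + 1) * norm (x - y)" for x y
  proof -
    have "F x - F y = L (x - y) + ((X (P x) - L (P x)) - (X (P y) - L (P y)))"
      by (simp add: F_def linear_diff[OF L(1)])
    moreover have "norm ((X (P x) - L (P x)) - (X (P y) - L (P y))) \<le> norm (x - y)"
      using r(3)[rule_format, OF P(1)[of x] P(1)[of y]] P(2)[of x y] by linarith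
    ultimately show ?thesis
      using B(2)[of "x - y"] norm_triangle_ineq[of "L (x - y)" "(X (P x) - L (P x)) - (X (P y) - L (P y))"]
      by (simp add: distrib_right)
  qed
  have F0: "F 0 = 0" using FX[of 0] r(1) X0 by simp
  obtain \<psi> where \<psi>: "\<And>x. \<psi> x 0 = x" "\<And>x t. (\<psi> x has_vector_derivative F (\<psi> x t)) (at t)"
    using lipschitz_flow_exists[OF _ lip F0] B(1) by (metis add_pos_pos zero_less_one)
  have "discriminant X \<noteq> 0" using disc assms(2) by simp
  then obtain u z where u: "L u = axis 5 1" "R2 u = u" and z: "L z = 0" "R2 z = z" "z \<noteq> 0"
    unfolding L_def using linearization_preimage[OF X] linearization_kernel[OF X] by metis
  interpret reversible_center F "B + 1" \<psi> L \<alpha> H r u z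
  proof
    show "F (R2 x) = - R2 (F x)" for x
      using P(1)[of x] r(2) H(5)[of "P x"]
      by (auto simp: F_def P(4) L(2) linear_diff[OF linear_R2] linear_add[OF linear_R2])
    show "\<exists>\<rho>>0. \<forall>x. norm x \<le> \<rho> \<longrightarrow> norm (F x - L x) \<le> \<epsilon> * norm x" if \<epsilon>: "0 < \<epsilon>" for \<epsilon>
    proof -
      obtain r' where r': "0 < r'" "\<forall>x\<in>cball 0 r'. \<forall>y\<in>cball 0 r'. norm ((X x - L x) - (X y - L y)) \<le> \<epsilon> * norm (x - y)"
        using strict[OF \<epsilon>] by blast
      have "norm (F x - L x) \<le> \<epsilon> * norm x" if "norm x \<le> min r r'" for x
        using r'(2)[rule_format, of x 0] r'(1) that FX[of x] X0 linear_0[OF L(1)] by simp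
      then show ?thesis using r(1) r'(1) by (metis min_less_iff_conj)
    qed
    show "smooth_on (ball 0 r) H"
      by (rule smooth_on_subset[OF H(2)]) (use r(2) in auto)
    show "F x = ham_vf H x" if "x \<in> ball 0 r" for x
    proof -
      have "x \<in> cball 0 r" using that by simp
      then show ?thesis using FX H(4) r(2) by (metis subsetD)
    qed
  qed (use B(1) lip F0 \<psi> L u z assms(2) r(1) in \<open>auto simp: linear_add linear_scale\<close>)
  show ?thesis
    by (rule orb_families) (use FX in auto)
qed

section \<open>The set of elliptic germs\<close>

text \<open>Smoothness of the germ is part of the definition because the topology lives on smooth germs;
  \<open>Omega2_smooth_germ\<close> supplies it for reversible Hamiltonian fields.\<close>

definition elliptic_germs :: "(real^6 \<Rightarrow> real^6) set" where
  "elliptic_germs = {X. smooth_germ X \<and> discriminant X < 0}"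

text \<open>The discriminant is a continuous function of the Jacobian matrix at the origin, so first
  derivatives on the compact set \<open>{0}\<close> control it.\<close>

lemma openin_elliptic_germs: "openin Cinf_topology elliptic_germs"
  unfolding openin_Cinf_topology Cinf_open_def
proof (intro conjI allI impI)
  show "elliptic_germs \<subseteq> Collect smooth_germ" by (auto simp: elliptic_germs_def)
  fix V and f :: "real^6 \<Rightarrow> real^6"
  assume f: "open V \<and> 0 \<in> V \<and> f \<in> elliptic_germs \<and> smooth_on V f"
  define \<Delta> where "\<Delta> m = m $ 1 $ 6 * m $ 2 $ 5 - m $ 1 $ 5 * m $ 2 $ 6
     + m $ 3 $ 6 * m $ 4 $ 5 - m $ 3 $ 5 * m $ 4 $ 6" for m :: "real^6^6"
  define mat where "mat g = (\<chi> i j. entry g i j)" for g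
  have disc: "discriminant g = \<Delta> (mat g)" for g
    by (simp add: discriminant_def \<Delta>_def mat_def)
  have "isCont \<Delta> (mat f)"
    unfolding \<Delta>_def by (intro continuous_intros)
  moreover have "\<Delta> (mat f) < 0" using f disc by (auto simp: elliptic_germs_def)
  ultimately have "\<forall>\<^sub>F m in nhds (mat f). \<Delta> m < 0"
    by (metis isCont_def order_tendstoD(2) tendsto_at_iff_tendsto_nhds)
  then obtain e where e: "0 < e" "\<And>m. dist m (mat f) < e \<Longrightarrow> \<Delta> m < 0"
    by (auto simp: eventually_nhds_metric)
  show "\<exists>K k e. compact K \<and> K \<subseteq> V \<and> 0 < e \<and>
         (\<forall>g. smooth_on V g \<and>
              (\<forall>x\<in>K. \<forall>js. length js \<le> k \<longrightarrow> dist (partials js g x) (partials js f x) < e)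
            \<longrightarrow> g \<in> elliptic_germs)"
  \<comment> \<open>The norm of a matrix is at most the sum of the absolute values of its 36 entries.\<close>
  proof (rule exI[of _ "{0}"], rule exI[of _ 1], rule exI[of _ "e / 36"], intro conjI allI impI)
    fix g assume g: "smooth_on V g \<and>
      (\<forall>x\<in>{0}. \<forall>js. length js \<le> 1 \<longrightarrow> dist (partials js g x) (partials js f x) < e / 36)"
    have row: "norm ((mat g - mat f) $ i) < e / 6" for i
    proof -
      have "norm ((mat g - mat f) $ i) \<le> (\<Sum>j\<in>UNIV. \<bar>(mat g - mat f) $ i $ j\<bar>)"
        by (rule norm_le_l1_cart)
      also have "\<dots> < (\<Sum>j\<in>(UNIV :: 6 set). e / 36)"
      proof (rule sum_strict_mono)
        fix j :: 6
        have "\<bar>(partials [j] g 0 - partials [j] f 0) $ i\<bar> \<le> norm (partials [j] g 0 - partials [j] f 0)"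
          by (rule component_le_norm_cart)
        also have "\<dots> < e / 36" using g[THEN conjunct2, rule_format, of 0 "[j]"] by (simp add: dist_norm)
        finally show "\<bar>(mat g - mat f) $ i $ j\<bar> < e / 36" by (simp add: mat_def entry_def)
      qed auto
      finally show ?thesis by simp
    qed
    have "norm (mat g - mat f) \<le> (\<Sum>i\<in>UNIV. norm ((mat g - mat f) $ i))"
      unfolding norm_vec_def by (rule L2_set_le_sum) simp
    also have "\<dots> < (\<Sum>i\<in>(UNIV :: 6 set). e / 6)"
      by (rule sum_strict_mono) (use row in auto)
    finally have "dist (mat g) (mat f) < e" by (simp add: dist_norm)
    then have "discriminant g < 0" using e(2) disc by simp
    then show "g \<in> elliptic_germs" using g f by (auto simp: elliptic_germs_def smooth_germ_def)
  qed (use f e(1) in auto)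
qed

text \<open>Its flow rotates the planes \<open>(x\<^sub>1, x\<^sub>3)\<close> and \<open>(y\<^sub>1, y\<^sub>3)\<close>
  with unit speed and fixes \<open>x\<^sub>2\<close> and \<open>y\<^sub>2\<close>. Being quadratic it
  satisfies the Birkhoff condition.\<close>

definition model_hamiltonian :: "real^6 \<Rightarrow> real" where
  "model_hamiltonian x = x $ 1 * x $ 6 - x $ 2 * x $ 5"

definition model :: "real^6 \<Rightarrow> real^6" where
  "model x = vector [- (x $ 5), - (x $ 6), 0, 0, x $ 1, x $ 2]"

lemma model_nth: "model x $ 1 = - (x $ 5)" "model x $ 2 = - (x $ 6)" "model x $ 3 = 0"
    "model x $ 4 = 0" "model x $ 5 = x $ 1" "model x $ 6 = x $ 2"
  unfolding model_def by (rule vector_6_nth)+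

lemma linear_model: "linear model"
  by (rule linearI) (simp_all add: vec_eq_iff forall_6 model_nth)

lemma partials_model_hamiltonian:
  "partials [j] model_hamiltonian = (\<lambda>x. axis j 1 $ 1 * x $ 6 + x $ 1 * axis j 1 $ 6 - axis j 1 $ 2 * x $ 5 - x $ 2 * axis j 1 $ 5)"
proof
  fix x :: "real^6"
  have "(model_hamiltonian has_derivative
      (\<lambda>h. x $ 1 * h $ 6 + h $ 1 * x $ 6 - (x $ 2 * h $ 5 + h $ 2 * x $ 5))) (at x)"
    unfolding model_hamiltonian_def
    by (auto intro!: derivative_eq_intros bounded_linear_imp_has_derivative[OF bounded_linear_vec_nth])
  from frechet_derivative_at[OF this, symmetric]
  show "partials [j] model_hamiltonian x = axis j 1 $ 1 * x $ 6 + x $ 1 * axis j 1 $ 6 - axis j 1 $ 2 * x $ 5 - x $ 2 * axis j 1 $ 5"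
    by (simp add: partials.simps)
qed

lemma model_is_hamiltonian: "is_hamiltonian_of model_hamiltonian model"
proof -
  have D: "model_hamiltonian differentiable (at x)" for x
    unfolding model_hamiltonian_def
    by (intro differentiable_diff differentiable_mult bounded_linear_imp_differentiable bounded_linear_vec_nth)
  have "linear (partials [j] model_hamiltonian)" for j
    unfolding partials_model_hamiltonian
    by (rule linearI) (simp_all add: algebra_simps)
  from smooth_onI_partials[OF D linear_smooth_on(1)[OF this]]
  have "smooth_on UNIV model_hamiltonian" .
  then have "smooth_germ model_hamiltonian" unfolding smooth_germ_def by blast
  moreover have "model x = ham_vf model_hamiltonian x" for x
    by (simp add: vec_eq_iff forall_6 model_nth ham_vf_nth partials_model_hamiltonian axis_def)
  ultimately show ?thesis by (simp add: is_hamiltonian_of_def)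
qed

lemma quadratic_part_model: "quadratic_part model_hamiltonian x = model_hamiltonian x"
proof -
  have lin: "linear (partials [j] model_hamiltonian)" for j
    unfolding partials_model_hamiltonian
    by (rule linearI) (simp_all add: algebra_simps)
  have two: "partials [i, j] model_hamiltonian 0 = partials [j] model_hamiltonian (axis i 1)" for i j
    using linear_smooth_on(2)[OF lin[of j], of i 0] by (simp add: partials.simps)
  show ?thesis
    unfolding quadratic_part_def two partials_model_hamiltonian sum_UNIV_6
    by (simp add: axis_def model_hamiltonian_def)
qed

lemma model_Omega2: "model \<in> Omega2"
proof -
  have "model (R2 x) = - R2 (model x)" for x
    by (simp add: vec_eq_iff forall_6 model_nth)
  then show ?thesis
    using model_is_hamiltonian linear_0[OF linear_model] by (auto simp: Omega2_def)
qed

lemma model_Birkhoff: "model \<in> Omega2_Birkhoff"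
proof -
  have "poisson (quadratic_part model_hamiltonian) model_hamiltonian x = 0" for x
  proof -
    have "quadratic_part model_hamiltonian = model_hamiltonian"
      by (intro ext quadratic_part_model)
    then show ?thesis by (simp add: poisson_def symp_def)
  qed
  then show ?thesis
    unfolding Omega2_Birkhoff_def using model_Omega2 model_is_hamiltonian by auto
qed

text \<open>The power series has the images of the unit vectors as coefficients at the multi-indices of
  degree one.\<close>

lemma linear_analytic_germ:
  fixes f :: "real^'n \<Rightarrow> 'b::real_normed_vector"
  assumes "linear f"
  shows "analytic_germ f"
proof -
  define c :: "nat^'n \<Rightarrow> 'b" where
    "c m = (\<Sum>k\<in>UNIV. if m = axis k 1 then f (axis k 1) else 0)" for m
  have inj: "inj (\<lambda>k. axis k 1 :: nat^'n)"
    by (auto simp: inj_def axis_eq_axis)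
  have c_axis: "c (axis k 1) = f (axis k 1)" for k
    unfolding c_def by (simp add: axis_eq_axis)
  have "((\<lambda>m. (\<Prod>i\<in>UNIV. x $ i ^ (m $ i)) *\<^sub>R c m) has_sum f x) UNIV" for x
  proof -
    let ?t = "\<lambda>m. (\<Prod>i\<in>UNIV. x $ i ^ (m $ i)) *\<^sub>R c m"
    let ?A = "range (\<lambda>k. axis k 1 :: nat^'n)"
    have "(\<Prod>i\<in>UNIV. x $ i ^ ((axis k 1 :: nat^'n) $ i)) = x $ k" for k
    proof -
      have "(\<Prod>i\<in>UNIV. x $ i ^ ((axis k 1 :: nat^'n) $ i)) = (\<Prod>i\<in>UNIV. if i = k then x $ k else 1)"
        by (intro prod.cong) (auto simp: axis_def)
      then show ?thesis by simp
    qed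
    then have "sum ?t ?A = (\<Sum>k\<in>UNIV. x $ k *\<^sub>R f (axis k 1))"
      using inj by (simp add: sum.reindex c_axis del: One_nat_def)
    also have "\<dots> = f (\<Sum>k\<in>UNIV. x $ k *\<^sub>R axis k 1)"
      using assms by (simp add: linear_sum linear_scale)
    also have "(\<Sum>k\<in>UNIV. x $ k *\<^sub>R axis k 1) = x"
      using basis_expansion[of x] by (simp add: scalar_mult_eq_scaleR)
    finally have "(?t has_sum f x) ?A"
      using has_sum_finite[of ?A ?t] by simp
    moreover have "?t m = 0" if "m \<notin> ?A" for m
    proof -
      have "c m = 0" unfolding c_def using that by (intro sum.neutral) auto
      then show ?thesis by simp
    qed
    ultimately show ?thesis
      by (subst has_sum_cong_neutral[where T = ?A and g = ?t]) auto
  qed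
  then show ?thesis unfolding analytic_germ_def by (intro exI[of _ c]) simp
qed

lemma model_analytic: "model \<in> Omega2_analytic"
  using model_Omega2 linear_analytic_germ[OF linear_model] by (simp add: Omega2_analytic_def)

lemma model_elliptic: "model \<in> elliptic_germs"
proof -
  have "smooth_germ model"
    unfolding smooth_germ_def using linear_smooth_on(1)[OF linear_model] by blast
  moreover have "discriminant model < 0"
    by (simp add: discriminant_def entry_def linear_smooth_on(2)[OF linear_model] model_nth axis_def)
  ultimately show ?thesis by (simp add: elliptic_germs_def)
qed

lemma Omega2_smooth_germ: "X \<in> Omega2 \<Longrightarrow> smooth_germ X"
  using Omega2_representative by (metis centre_in_ball open_ball smooth_germ_def)

lemma same_jet_discriminant:
  assumes "same_jet 3 X Y" shows "discriminant X = discriminant Y"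
proof -
  have "partials [j] X 0 = partials [j] Y 0" for j
    using assms by (simp add: same_jet_def)
  then show ?thesis by (simp add: discriminant_def entry_def)
qed

theorem theoremC:
  shows "\<forall>\<Omega> \<in> {Omega2_Birkhoff, Omega2_analytic}.
    \<exists>U. openin (subtopology Cinf_topology \<Omega>) U \<and> U \<noteq> {} \<and>
      (\<forall>X\<in>\<Omega>. \<forall>Y\<in>\<Omega>. same_jet 3 X Y \<longrightarrow> (X \<in> U \<longleftrightarrow> Y \<in> U)) \<and>
      (\<forall>X\<in>U. \<exists>\<alpha>>0. nonzero_eigenvalues_pm_i_double (linear_part X) \<alpha> \<and>
        (\<exists>\<epsilon>>0. \<exists>\<gamma>1 \<gamma>2 T1 T2.
          periodic_family X \<epsilon> \<gamma>1 T1 \<and> periodic_family X \<epsilon> \<gamma>2 T2 \<and>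
          (\<forall>\<sigma>\<in>{-\<epsilon><..<\<epsilon>} - {0}. \<forall>\<sigma>'\<in>{-\<epsilon><..<\<epsilon>} - {0}.
             \<forall>l\<in>{0..2*pi}. \<forall>l'\<in>{0..2*pi}. range (\<gamma>1 \<sigma> l) \<noteq> range (\<gamma>2 \<sigma>' l')) \<and>
          (\<forall>(\<gamma>, T)\<in>{(\<gamma>1, T1), (\<gamma>2, T2)}. \<forall>l\<in>{0..2*pi}.
             (\<forall>r>0. \<forall>\<^sub>F \<sigma> in at 0. range (\<gamma> \<sigma> l) \<subseteq> ball 0 r) \<and>
             ((\<lambda>\<sigma>. T \<sigma> l) \<longlongrightarrow> 2 * pi / \<alpha>) (at 0))))"
proof (fold has_two_periodic_families_def, rule ballI)
  fix \<Omega> assume "\<Omega> \<in> {Omega2_Birkhoff, Omega2_analytic}"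
  then have \<Omega>: "\<Omega> \<subseteq> Omega2" "model \<in> \<Omega>"
    using model_Birkhoff model_analytic by (auto simp: Omega2_Birkhoff_def Omega2_analytic_def)
  let ?U = "elliptic_germs \<inter> \<Omega>"
  show "\<exists>U. openin (subtopology Cinf_topology \<Omega>) U \<and> U \<noteq> {} \<and>
      (\<forall>X\<in>\<Omega>. \<forall>Y\<in>\<Omega>. same_jet 3 X Y \<longrightarrow> (X \<in> U \<longleftrightarrow> Y \<in> U)) \<and>
      (\<forall>X\<in>U. \<exists>\<alpha>>0. nonzero_eigenvalues_pm_i_double (linear_part X) \<alpha> \<and>
        has_two_periodic_families X \<alpha>)"
  proof (intro exI[of _ ?U] conjI ballI impI)
    show "openin (subtopology Cinf_topology \<Omega>) ?U"
      using openin_elliptic_germs by (auto simp: openin_subtopology)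
    show "?U \<noteq> {}" using \<Omega> model_elliptic by blast
    show "X \<in> ?U \<longleftrightarrow> Y \<in> ?U" if "X \<in> \<Omega>" "Y \<in> \<Omega>" "same_jet 3 X Y" for X Y
      using that \<Omega>(1) Omega2_smooth_germ same_jet_discriminant by (auto simp: elliptic_germs_def)
    fix X assume "X \<in> ?U"
    define \<alpha> where "\<alpha> = sqrt (- discriminant X)"
    have \<alpha>: "0 < \<alpha>" "discriminant X = - \<alpha>\<^sup>2" "X \<in> Omega2"
      using \<open>X \<in> ?U\<close> \<Omega>(1) by (auto simp: \<alpha>_def elliptic_germs_def)
    show "\<exists>\<alpha>>0. nonzero_eigenvalues_pm_i_double (linear_part X) \<alpha> \<and> has_two_periodic_families X \<alpha>"
      using nonzero_eigenvalues_Omega2[OF \<alpha>(3,1,2)] periodic_families_Omega2[OF \<alpha>(3,1,2)] \<alpha>(1) by blast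
  qed
qed

end
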